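(* Consider the optimization problem of minimizing $f(x)=c(x)+\sum_{i=1}^Nf_i(x_i)$ subject to $g(x)\le0$ and $x\in X=X_1\times\cdots\times X_N$, where each $X_i\subset\mathbb{R}^{n_i}$ is non-empty, compact and convex, each $f_i$ and $c$ are convex and $C^2$, $g:\mathbb{R}^n\to\mathbb{R}^m$ is convex and $C^2$, and there is $\bar{x}\in X$ with $g(\bar{x})<0$. Fix regularization parameters $\kappa=(\alpha,\beta)$ with $\alpha\in(0,L_p)$ and $\beta>0$, and let $(\hat{x}_\kappa,\hat{\mu}_\kappa)$ be the unique saddle point of $L_\kappa$ over $X\times\mathbb{R}^m_+$. Consider a run of the asynchronous primal-dual algorithm described in the context, satisfying all the timing and communication requirements given there, and such that for every $t$ the sets $\{X^t(s)\}_{s\in\mathbb{N}}$ defined there satisfy properties (a)–(d) listed there. Let $\gamma\in(0,2/L_p)$ and let the dual step-size satisfy $$0<\rho<\rho_0:=\min\Big\{\frac{2\alpha}{M_g^2+2\alpha\beta},\ \frac{2\beta}{1+\beta^2}\Big\},\qquad M_g=\max_{x\in X}\|\nabla g(x)\|.$$ Then, with $q_d:=(1-\rho\beta)^2+\rho^2\in(0,1)$, for all $t\ge0$ $$\|\mu(t+1)-\hat{\mu}_\kappa\|^2\le q_d^{t+1}\|\mu(0)-\hat{\mu}_\kappa\|^2+\sum_{\ell=0}^{t}q_d^{t-\ell}\Big(q_dNM_g^2L_x^2q_p^{2c(\ell)}+2\sqrt{N}\rho^2M_g^2L_xD_xq_p^{c(\ell)}\Big),$$ where $D_x:=\max_{x,y\in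 X}\|x-y\|$ and $L_x:=\max_{1\le i\le N}\max_{x_i,y_i\in X_i}\|x_i-y_i\|$.
   Context: **Notation.** $\|\cdot\|=\|\cdot\|_2$ is the Euclidean norm; $x=(x_1,\dots,x_N)$ with blocks $x_i\in\mathbb{R}^{n_i}$, $n=\sum_i n_i$; $\|x\|_{2,\infty}:=\max_i\|x_i\|_2$; $\Pi_S$ is Euclidean projection onto $S$. $L_\kappa(x,\mu)=f(x)+\frac{\alpha}{2}\|x\|^2+\mu^Tg(x)-\frac{\beta}{2}\|\mu\|^2$. With $f^*=\min_Xf$ and $\bar{x}$ a fixed Slater point, $$M=\Big\{\mu\in\mathbb{R}^m_+:\|\mu\|_1\le\frac{f(\bar{x})+\frac{\alpha}{2}\|\bar{x}\|^2-f^*}{\min_j\{-g_j(\bar{x})\}}\Big\}$$ (this set contains $\hat\mu_\kappa$). $L_p$ is the maximum over $\mu\in M$ of the Lipschitz constant of $\nabla_xL_\kappa(\cdot,\mu)$ on $X$. $q_p:=\max\{|1-\gamma\alpha|,|1-\gamma L_p|\}$, and $\hat{x}^t:=\arg\min_{x\in X}L_\kappa(x,\mu(t))$. **Algorithm.** There are $N$ agents and a cloud. Agent $i$ stores a vector $x^i=(x^i_1,\dots,x^i_N)$; $x^i(k;t)$ is its value at time $k\in K=\mathbb{N}$ when the dual vector onboard is $\mu(t)$, $t\in T=\mathbb{N}$. Agent $j\ne i$ is an essential neighbor of agent $i$ ($j\in\mathcal{N}_i$) if $\nabla_{x_j}L_\kappa$ depends on $x_i$; only essential neighbors communicate with each other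 (blocks $x^i_j$ with $j\notin\mathcal{N}_i$ do not influence agent $i$'s updates, and one proceeds as though each agent stores a full state vector). All agents and the cloud are initialized with $x(0)\in X$, $\mu(0)\in M$. Let $K^i\subset K$ be the set of times at which agent $i$ computes updates. Then $x^i_i(k+1;t)=\Pi_{X_i}[x^i_i(k;t)-\gamma\nabla_{x_i}L_\kappa(x^i(k;t),\mu(t))]$ if $k\in K^i$, and $x^i_i(k+1;t)=x^i_i(k;t)$ otherwise. For $j\ne i$, $x^i_j(k+1;t)=x^j_j(\tau^i_j(k+1);t)$ if agent $i$ receives agent $j$'s state at time $k+1$, and $x^i_j(k+1;t)=x^i_j(k;t)$ otherwise; here $\tau^i_j(k)\le k$ is the time at which the value $x^i_j(k;t)$ was originally computed by agent $j$. Agents send their own blocks to essential neighbors and to the cloud at arbitrary times. With $\tau^c_i(t)$ the time at which agent $i$ computed the state it most recently sent to the cloud, the cloud forms $x^c_t=(x^1_1(\tau^c_1(t);t),\dots,x^N_N(\tau^c_N(t);t))$. After every agent has sent it a state computed with $\mu(t)$ onboard, the cloud computes $\mu(t+1)=\Pi_M[\mu(t)+\rho(g(x^c_t)-\beta\mu(t))]$ and sends it to all agents, which continue from the states they currently hold. **Timing and communication requirements.** Each $K^i$ and $T$ are infinite; for any sequence $k_d\to\infty$ in $K^i$, $\tau^i_j(k_d)\to\infty$ for all $j\in\mathcal{N}_i$; for $t_d\to\infty$ in $T$, $\tau^c_i(t_d)\to\infty$ for all $i$. Each $\mu(t+1)$ sent by the cloud arrives in finite time. A transmission between agents sent while $\mu(t)$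 is onboard is used only if received before $\mu(t+1)$. All transmissions arrive in the order sent. There is an increasing sequence of times $\{k_t\}_{t\in T}$ such that only $\mu(t)$ is used in the agents' updates at times $k_t\le k<k_{t+1}$; all agents receive $\mu(t)$ simultaneously at time $k_t$. **Sets.** $D(k_t):=\max_i\|x^i(k_t;t)-\hat{x}^t\|_{2,\infty}$ and $X^t(s)=\{y\in X:\|y-\hat{x}^t\|_{2,\infty}\le q_p^sD(k_t)\}$. Properties: (a) $\cdots\subset X^t(s+1)\subset X^t(s)\subset\cdots\subset X$; (b) $\lim_{s\to\infty}X^t(s)=\{\hat{x}^t\}$; (c) $X^t(s)=X^t_1(s)\times\cdots\times X^t_N(s)$ for some $X^t_i(s)\subset X_i$; (d) for all $y\in X^t(s)$ and all $i$, $\Pi_{X_i}[y_i-\gamma\nabla_{x_i}L_\kappa(y,\mu(t))]\in X^t_i(s+1)$. **Cycles.** After all agents have just received $\mu(t)$, the first cycle ends as soon as (i) each agent has computed a state update and (ii) each agent has sent that updated state to all of its essential neighbors and it has been received by them. Each subsequent cycle is completed when the preceding one has ended and (i), (ii) are met again. $c(t)$ is the number of cycles completed with $\mu(t)$ onboard before the first agent sends its state to the cloud for use in computing $\mu(t+1)$. *)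

theory Defs
  imports "HOL-Analysis.Analysis"
begin

definition C2 :: "('a::real_normed_vector \<Rightarrow> 'b::real_normed_vector) \<Rightarrow> bool" where
  "C2 h \<longleftrightarrow> (\<exists>h' h''.
     (\<forall>x. (h has_derivative blinfun_apply (h' x)) (at x)) \<and>
     (\<forall>x. (h' has_derivative blinfun_apply (h'' x)) (at x)) \<and>
     continuous_on UNIV (h'' :: 'a \<Rightarrow> 'a \<Rightarrow>\<^sub>L 'a \<Rightarrow>\<^sub>L 'b))"

definition gradient :: "('a::real_inner \<Rightarrow> real) \<Rightarrow> 'a \<Rightarrow> 'a" where
  "gradient h x = (THE D. GDERIV h x :> D)"

definition lipschitz_const :: "('a::metric_space \<Rightarrow> 'b::metric_space) \<Rightarrow> 'a set \<Rightarrow> real" where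
  "lipschitz_const h S = Inf {C. C-lipschitz_on S h}"

definition nonneg_orthant :: "(real^'m) set" where
  "nonneg_orthant = {\<mu>. \<forall>j. 0 \<le> \<mu> $ j}"


text \<open>
  The agents are the elements of the finite type \<open>'a\<close>, so \<open>N = CARD('a)\<close>. The coordinates of
  the full vector are partitioned among the agents by \<open>owner\<close>, and \<open>n\<^sub>i\<close> is the number of
  coordinates owned by agent \<open>i\<close>. The space of the \<open>i\<close>-th block is identified, isometrically,
  with the subspace \<open>range (block P i)\<close> of vectors vanishing outside these coordinates.
  Consequently \<open>local_set P i\<close> is a subset of that subspace, and \<open>local_cost P i\<close> is only
  ever applied to its elements.
\<close>

record ('n::finite, 'm::finite, 'a::finite) problem =
  owner :: "'n \<Rightarrow> 'a"
  local_set :: "'a \<Rightarrow> (real^'n) set"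
  coupling_cost :: "real^'n \<Rightarrow> real"
  local_cost :: "'a \<Rightarrow> real^'n \<Rightarrow> real"
  constr :: "real^'n \<Rightarrow> real^'m"
  slater :: "real^'n"
  reg_p :: real  \<comment> \<open>\<open>\<alpha>\<close>\<close>
  reg_d :: real  \<comment> \<open>\<open>\<beta>\<close>\<close>

definition block :: "('n::finite, 'm::finite, 'a::finite) problem \<Rightarrow> 'a \<Rightarrow> real^'n \<Rightarrow> real^'n" where
  "block P i x = (\<chi> c. if owner P c = i then x $ c else 0)"

definition norm2inf :: "('n::finite, 'm::finite, 'a::finite) problem \<Rightarrow> real^'n \<Rightarrow> real" where
  "norm2inf P x = Max (range (\<lambda>i. norm (block P i x)))"

definition feasible :: "('n::finite, 'm::finite, 'a::finite) problem \<Rightarrow> (real^'n) set" where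
  "feasible P = {x. \<forall>i. block P i x \<in> local_set P i}"

definition objective :: "('n::finite, 'm::finite, 'a::finite) problem \<Rightarrow> real^'n \<Rightarrow> real" where
  "objective P x = coupling_cost P x + (\<Sum>i\<in>UNIV. local_cost P i (block P i x))"

definition Lagr :: "('n::finite, 'm::finite, 'a::finite) problem \<Rightarrow> real^'n \<Rightarrow> real^'m \<Rightarrow> real" where
  "Lagr P x \<mu> = objective P x + reg_p P / 2 * (norm x)\<^sup>2 + \<mu> \<bullet> constr P x
                - reg_d P / 2 * (norm \<mu>)\<^sup>2"

definition grad_x :: "('n::finite, 'm::finite, 'a::finite) problem \<Rightarrow> real^'n \<Rightarrow> real^'m \<Rightarrow> real^'n" where
  "grad_x P x \<mu> = gradient (\<lambda>y. Lagr P y \<mu>) x"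

definition saddle_point ::
  "('n::finite, 'm::finite, 'a::finite) problem \<Rightarrow> real^'n \<Rightarrow> real^'m \<Rightarrow> bool" where
  "saddle_point P x \<mu> \<longleftrightarrow> x \<in> feasible P \<and> \<mu> \<in> nonneg_orthant \<and>
     (\<forall>x'\<in>feasible P. \<forall>\<mu>'\<in>nonneg_orthant.
        Lagr P x \<mu>' \<le> Lagr P x \<mu> \<and> Lagr P x \<mu> \<le> Lagr P x' \<mu>)"

definition dual_set :: "('n::finite, 'm::finite, 'a::finite) problem \<Rightarrow> (real^'m) set" where
  "dual_set P = {\<mu> \<in> nonneg_orthant.
     (\<Sum>j\<in>UNIV. \<bar>\<mu> $ j\<bar>) \<le>
       (objective P (slater P) + reg_p P / 2 * (norm (slater P))\<^sup>2 - Inf (objective P ` feasible P))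
       / Min (range (\<lambda>j. - (constr P (slater P) $ j)))}"

definition L_p :: "('n::finite, 'm::finite, 'a::finite) problem \<Rightarrow> real" where
  "L_p P = (SUP \<mu>\<in>dual_set P. lipschitz_const (\<lambda>x. grad_x P x \<mu>) (feasible P))"

definition M_g :: "('n::finite, 'm::finite, 'a::finite) problem \<Rightarrow> real" where
  "M_g P = (SUP x\<in>feasible P. onorm (frechet_derivative (constr P) (at x)))"

definition D_x :: "('n::finite, 'm::finite, 'a::finite) problem \<Rightarrow> real" where
  "D_x P = diameter (feasible P)"

definition L_x :: "('n::finite, 'm::finite, 'a::finite) problem \<Rightarrow> real" where
  "L_x P = Max (range (\<lambda>i. diameter (local_set P i)))"

definition q_p :: "('n::finite, 'm::finite, 'a::finite) problem \<Rightarrow> real \<Rightarrow> real" where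
  "q_p P \<gamma> = max \<bar>1 - \<gamma> * reg_p P\<bar> \<bar>1 - \<gamma> * L_p P\<bar>"

definition q_d :: "('n::finite, 'm::finite, 'a::finite) problem \<Rightarrow> real \<Rightarrow> real" where
  "q_d P \<rho> = (1 - \<rho> * reg_d P)\<^sup>2 + \<rho>\<^sup>2"

definition rho0 :: "('n::finite, 'm::finite, 'a::finite) problem \<Rightarrow> real" where
  "rho0 P = min (2 * reg_p P / ((M_g P)\<^sup>2 + 2 * reg_p P * reg_d P))
                (2 * reg_d P / (1 + (reg_d P)\<^sup>2))"

definition neighbors :: "('n::finite, 'm::finite, 'a::finite) problem \<Rightarrow> 'a \<Rightarrow> 'a set" where
  "neighbors P i = {j. j \<noteq> i \<and>
     (\<exists>\<mu>\<in>nonneg_orthant. \<exists>x y. (\<forall>l. l \<noteq> i \<longrightarrow> block P l x = block P l y) \<and>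
        block P j (grad_x P x \<mu>) \<noteq> block P j (grad_x P y \<mu>))}"

definition standing_assumptions :: "('n::finite, 'm::finite, 'a::finite) problem \<Rightarrow> bool" where
  "standing_assumptions P \<longleftrightarrow>
     (\<forall>i. local_set P i \<subseteq> range (block P i) \<and> local_set P i \<noteq> {} \<and>
          compact (local_set P i) \<and> convex (local_set P i)) \<and>
     convex_on UNIV (coupling_cost P) \<and> C2 (coupling_cost P) \<and>
     (\<forall>i. convex_on UNIV (\<lambda>x. local_cost P i (block P i x)) \<and>
          C2 (\<lambda>x. local_cost P i (block P i x))) \<and>
     (\<forall>j. convex_on UNIV (\<lambda>x. constr P x $ j)) \<and> C2 (constr P) \<and>
     slater P \<in> feasible P \<and> (\<forall>j. constr P (slater P) $ j < 0)"


text \<open>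
  A run. Because all agents switch from \<open>\<mu>(t)\<close> to \<open>\<mu>(t+1)\<close> at time \<open>k\<^sub>t\<^sub>+\<^sub>1\<close> and continue from
  the states they hold, \<open>x\<^sup>i(k;t)\<close> is written \<open>state R i k\<close>, the onboard dual vector being
  determined by the interval \<open>k\<^sub>t \<le> k < k\<^sub>t\<^sub>+\<^sub>1\<close> containing \<open>k\<close>. For messages, \<open>received R i j k\<close>
  says that agent \<open>i\<close> receives agent \<open>j\<close>'s own block at time \<open>k\<close>, and \<open>sent R i j k\<close> is the time
  at which \<open>j\<close> sent it (the most recently sent one, if several arrive simultaneously).
  Finally \<open>cloud_sent R i t\<close> is the time at which agent \<open>i\<close> sent the state that the cloud uses
  to compute \<open>\<mu>(t+1)\<close>.
\<close>

record ('n::finite, 'm::finite, 'a::finite) run =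
  state :: "'a \<Rightarrow> nat \<Rightarrow> real^'n"
  dual :: "nat \<Rightarrow> real^'m"
  switch :: "nat \<Rightarrow> nat"  \<comment> \<open>\<open>k\<^sub>t\<close>\<close>
  update_times :: "'a \<Rightarrow> nat set"  \<comment> \<open>\<open>K\<^sup>i\<close>\<close>
  received :: "'a \<Rightarrow> 'a \<Rightarrow> nat \<Rightarrow> bool"
  sent :: "'a \<Rightarrow> 'a \<Rightarrow> nat \<Rightarrow> nat"
  cloud_sent :: "'a \<Rightarrow> nat \<Rightarrow> nat"

text \<open>
  The time at which the own block held by agent \<open>j\<close> at time \<open>k\<close> was originally computed: an update
  performed at time \<open>l\<close> produces the state at time \<open>l + 1\<close>, and the initial state is stamped \<open>0\<close>.
\<close>

definition stamp :: "('n::finite, 'm::finite, 'a::finite) run \<Rightarrow> 'a \<Rightarrow> nat \<Rightarrow> nat" where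
  "stamp R j k = Max {l. l \<le> k \<and> (l = 0 \<or> l - 1 \<in> update_times R j)}"

primrec tau :: "('n::finite, 'm::finite, 'a::finite) run \<Rightarrow> 'a \<Rightarrow> 'a \<Rightarrow> nat \<Rightarrow> nat" where
  "tau R i j 0 = 0"
| "tau R i j (Suc k) =
     (if received R i j (Suc k) then stamp R j (sent R i j (Suc k)) else tau R i j k)"

definition tau_c :: "('n::finite, 'm::finite, 'a::finite) run \<Rightarrow> 'a \<Rightarrow> nat \<Rightarrow> nat" where
  "tau_c R i t = stamp R i (cloud_sent R i t)"

definition cloud_state ::
  "('n::finite, 'm::finite, 'a::finite) problem \<Rightarrow> ('n, 'm, 'a) run \<Rightarrow> nat \<Rightarrow> real^'n" where
  "cloud_state P R t = (\<Sum>i\<in>UNIV. block P i (state R i (tau_c R i t)))"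

definition primal_dual_run ::
  "('n::finite, 'm::finite, 'a::finite) problem \<Rightarrow> real \<Rightarrow> real \<Rightarrow> ('n, 'm, 'a) run \<Rightarrow> bool" where
  "primal_dual_run P \<gamma> \<rho> R \<longleftrightarrow>
     (\<exists>x0\<in>feasible P. \<forall>i. state R i 0 = x0) \<and>
     dual R 0 \<in> dual_set P \<and>
     (\<forall>t k i. switch R t \<le> k \<and> k < switch R (Suc t) \<longrightarrow>
        block P i (state R i (Suc k)) =
          (if k \<in> update_times R i
           then closest_point (local_set P i)
                  (block P i (state R i k) - \<gamma> *\<^sub>R block P i (grad_x P (state R i k) (dual R t)))
           else block P i (state R i k))) \<and>
     (\<forall>k i j. j \<noteq> i \<longrightarrow>
        block P j (state R i (Suc k)) =
          (if received R i j (Suc k)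
           then block P j (state R j (tau R i j (Suc k)))
           else block P j (state R i k))) \<and>
     (\<forall>t. dual R (Suc t) =
        closest_point (dual_set P)
          (dual R t + \<rho> *\<^sub>R (constr P (cloud_state P R t) - reg_d P *\<^sub>R dual R t)))"

definition timing_requirements ::
  "('n::finite, 'm::finite, 'a::finite) problem \<Rightarrow> ('n, 'm, 'a) run \<Rightarrow> bool" where
  "timing_requirements P R \<longleftrightarrow>
     strict_mono (switch R) \<and> switch R 0 = 0 \<and>
     (\<forall>i. infinite (update_times R i)) \<and>
     (\<forall>i. \<forall>j\<in>neighbors P i. \<forall>\<kappa>::nat \<Rightarrow> nat.
        (\<forall>d. \<kappa> d \<in> update_times R i) \<and> filterlim \<kappa> at_top sequentially \<longrightarrow>
        filterlim (\<lambda>d. tau R i j (\<kappa> d)) at_top sequentially) \<and>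
     (\<forall>i. \<forall>\<theta>::nat \<Rightarrow> nat. filterlim \<theta> at_top sequentially \<longrightarrow>
        filterlim (\<lambda>d. tau_c R i (\<theta> d)) at_top sequentially) \<and>
     \<comment> \<open>agent \<open>j\<close> sends only to its essential neighbors, and messages are not received before
         they are sent\<close>
     (\<forall>i j k. received R i j k \<longrightarrow> i \<in> neighbors P j \<and> sent R i j k \<le> k) \<and>
     \<comment> \<open>transmissions sent while \<open>\<mu>(t)\<close> is onboard are used only if received before \<open>\<mu>(t+1)\<close>\<close>
     (\<forall>i j k t. received R i j k \<and> switch R t \<le> sent R i j k \<and> sent R i j k < switch R (Suc t)
        \<longrightarrow> k < switch R (Suc t)) \<and>
     \<comment> \<open>transmissions arrive in the order sent\<close>
     (\<forall>i j k k'. received R i j k \<and> received R i j k' \<and> k < k' \<longrightarrow> sent R i j k \<le> sent R i j k') \<and>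
     \<comment> \<open>the states used by the cloud for \<open>\<mu>(t+1)\<close> were computed with \<open>\<mu>(t)\<close> onboard, and sent no
         later than the arrival of \<open>\<mu>(t+1)\<close>\<close>
     (\<forall>i t. switch R t < tau_c R i t \<and> cloud_sent R i t \<le> switch R (Suc t))"

definition x_hat ::
  "('n::finite, 'm::finite, 'a::finite) problem \<Rightarrow> ('n, 'm, 'a) run \<Rightarrow> nat \<Rightarrow> real^'n" where
  "x_hat P R t = arg_min_on (\<lambda>x. Lagr P x (dual R t)) (feasible P)"

definition D_switch ::
  "('n::finite, 'm::finite, 'a::finite) problem \<Rightarrow> ('n, 'm, 'a) run \<Rightarrow> nat \<Rightarrow> real" where
  "D_switch P R t = Max (range (\<lambda>i. norm2inf P (state R i (switch R t) - x_hat P R t)))"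

definition X_set ::
  "('n::finite, 'm::finite, 'a::finite) problem \<Rightarrow> real \<Rightarrow> ('n, 'm, 'a) run \<Rightarrow> nat \<Rightarrow> nat \<Rightarrow> (real^'n) set"
where
  "X_set P \<gamma> R t s = {y \<in> feasible P. norm2inf P (y - x_hat P R t) \<le> q_p P \<gamma> ^ s * D_switch P R t}"

definition X_set_properties ::
  "('n::finite, 'm::finite, 'a::finite) problem \<Rightarrow> real \<Rightarrow> ('n, 'm, 'a) run \<Rightarrow> nat \<Rightarrow> bool" where
  "X_set_properties P \<gamma> R t \<longleftrightarrow>
     (\<forall>s. X_set P \<gamma> R t (Suc s) \<subseteq> X_set P \<gamma> R t s \<and> X_set P \<gamma> R t s \<subseteq> feasible P) \<and>
     liminf (X_set P \<gamma> R t) = {x_hat P R t} \<and> limsup (X_set P \<gamma> R t) = {x_hat P R t} \<and>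
     (\<exists>B :: 'a \<Rightarrow> nat \<Rightarrow> (real^'n) set.
        (\<forall>i s. B i s \<subseteq> local_set P i) \<and>
        (\<forall>s. X_set P \<gamma> R t s = {y. \<forall>i. block P i y \<in> B i s}) \<and>
        (\<forall>s. \<forall>y\<in>X_set P \<gamma> R t s. \<forall>i.
           closest_point (local_set P i) (block P i y - \<gamma> *\<^sub>R block P i (grad_x P y (dual R t)))
             \<in> B i (Suc s)))"

text \<open>
  A cycle that started at time \<open>e\<close> is complete at time \<open>e'\<close> if every agent \<open>j\<close> has computed an
  update in the meantime and all its essential neighbors have received the resulting state
  (or a newer one, superseding it).
\<close>

definition cycle_complete ::
  "('n::finite, 'm::finite, 'a::finite) problem \<Rightarrow> ('n, 'm, 'a) run \<Rightarrow> nat \<Rightarrow> nat \<Rightarrow> bool" where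
  "cycle_complete P R e e' \<longleftrightarrow>
     (\<forall>j. \<exists>l\<in>update_times R j. e \<le> l \<and> l < e' \<and>
        (\<forall>i\<in>neighbors P j. \<exists>r\<le>e'. received R i j r \<and> Suc l \<le> tau R i j r))"

primrec cycle_end ::
  "('n::finite, 'm::finite, 'a::finite) problem \<Rightarrow> ('n, 'm, 'a) run \<Rightarrow> nat \<Rightarrow> nat \<Rightarrow> nat" where
  "cycle_end P R t 0 = switch R t"
| "cycle_end P R t (Suc n) = (LEAST e. cycle_complete P R (cycle_end P R t n) e)"

text \<open>
  A cycle ending at the very time of the first cloud transmission counts, since the state sent at
  time \<open>k\<close> is the one resulting from all updates performed before time \<open>k\<close>.
\<close>

definition cycles ::
  "('n::finite, 'm::finite, 'a::finite) problem \<Rightarrow> ('n, 'm, 'a) run \<Rightarrow> nat \<Rightarrow> nat" where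
  "cycles P R t = card {n. 1 \<le> n \<and> cycle_end P R t n \<le> Min (range (\<lambda>i. cloud_sent R i t))}"

end

theory Submission
  imports Defs
begin

text \<open>
  Write \<open>g\<close> for the constraints, \<open>x_t\<close> for the minimizer \<open>x_hat P R t\<close> of the Lagrangian at the
  multiplier \<open>\<mu>(t)\<close>, and \<open>y_t\<close> for the vector that the cloud assembles. The error splits into a
  primal and a dual part.

  Primal part: \<open>y_t\<close> lies in the box \<open>X_set P \<gamma> R t (cycles P R t)\<close> around \<open>x_t\<close>
  (\<open>cloud_state_in_X_set\<close>). This is the classical argument on asynchronous iterations with nested
  boxes. An agent whose own block and whose copies of the relevant blocks are in level \<open>s\<close> computes
  a block in level \<open>s + 1\<close>, and at the end of a cycle every agent has done so and every essential
  neighbor knows the result (\<open>informed_after_cycles\<close>). Two points need care. Agents hold outdated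
  copies of blocks that do not influence them; replacing these by the blocks of \<open>x_t\<close> does not change
  the update (\<open>update_in_X_block\<close>). And cycles have to end: the timing requirements guarantee fresh
  data from those agents whose gradient depends on the receiver, whereas a cycle requires delivery to
  those agents whose gradient depends on the sender. These conditions agree because the dependency
  relation is symmetric (\<open>neighbors_sym\<close>). Since the initial radius is at most \<open>L_x P\<close>, this yields
  \<open>\<parallel>y_t - x_t\<parallel> \<le> sqrt N L_x q_p\<^bsup>c(t)\<^esup>\<close> (\<open>dist_cloud_state_x_hat\<close>).

  Dual part: the multiplier \<open>muhat\<close> belongs to the set onto which the cloud projects, and is a fixed
  point of the exact projected dual step (\<open>saddle_point_multiplier_fixed_point\<close>). Hence, with
  \<open>\<Delta> = \<mu>(t) - muhat\<close>, \<open>a = g(y_t) - g(x_t)\<close> and \<open>b = g(x_t) - g(xhat)\<close>, nonexpansiveness of the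
  projection gives \<open>\<parallel>\<mu>(t+1) - muhat\<parallel> \<le> \<parallel>(1 - \<rho>\<beta>) \<Delta> + \<rho> (a + b)\<parallel>\<close>. Strong convexity of the
  Lagrangian in \<open>x\<close> gives \<open>\<Delta> \<bullet> b \<le> - \<alpha> \<parallel>x_t - xhat\<parallel>\<^sup>2\<close> (\<open>inner_constr_minimizers_ge\<close>), which
  compensates \<open>\<rho>\<^sup>2 \<parallel>b\<parallel>\<^sup>2\<close> for small \<open>\<rho>\<close>. What is left is a contraction with factor \<open>q_d\<close> plus the error
  terms in \<open>\<parallel>a\<parallel>\<^sup>2\<close> and \<open>\<parallel>a\<parallel> \<parallel>b\<parallel>\<close> (\<open>dual_step_le\<close>), to which the primal estimate applies; the
  theorem follows by unrolling this recursion.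
\<close>

section \<open>Block decomposition of the state space\<close>

lemma block_nth: "block P i x $ c = (if owner P c = i then x $ c else 0)"
  by (simp add: block_def)

lemma bounded_linear_block: "bounded_linear (block P i)"
  by (intro linear_conv_bounded_linear[THEN iffD1] linearI) (auto simp: vec_eq_iff block_nth)

lemmas linear_block = bounded_linear.linear[OF bounded_linear_block]

lemma block_add: "block P i (x + y) = block P i x + block P i y"
  by (rule linear_add[OF linear_block])

lemma block_diff: "block P i (x - y) = block P i x - block P i y"
  by (rule linear_diff[OF linear_block])

lemma block_scaleR: "block P i (r *\<^sub>R x) = r *\<^sub>R block P i x"
  by (rule linear_scale[OF linear_block])

lemma block_block: "block P i (block P j x) = (if i = j then block P j x else 0)"
  by (auto simp: vec_eq_iff block_nth)

lemma sum_block: "(\<Sum>i\<in>UNIV. block P i x) = x"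
  by (simp add: vec_eq_iff block_nth sum.delta')

lemma block_sum_blocks: "block P j (\<Sum>i\<in>UNIV. block P i (w i)) = block P j (w j)"
proof -
  have "block P j (\<Sum>i\<in>UNIV. block P i (w i)) = (\<Sum>i\<in>UNIV. block P j (block P i (w i)))"
    by (rule linear_sum[OF linear_block])
  also have "\<dots> = block P j (w j)"
    by (simp add: block_block)
  finally show ?thesis .
qed

lemma eq_if_blocks_eq:
  assumes "\<And>i. block P i x = block P i y"
  shows "x = y"
proof -
  have "x = (\<Sum>i\<in>UNIV. block P i x)" by (rule sum_block[symmetric])
  also have "\<dots> = (\<Sum>i\<in>UNIV. block P i y)" by (intro sum.cong refl assms)
  also have "\<dots> = y" by (rule sum_block)
  finally show ?thesis .
qed

lemma inner_block_left: "block P i x \<bullet> y = x \<bullet> block P i y"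
  unfolding inner_vec_def by (rule sum.cong) (auto simp: block_nth)

lemma norm_power2_eq_sum_blocks:
  "(norm x)\<^sup>2 = (\<Sum>i\<in>UNIV. (norm (block P i x))\<^sup>2)"
proof -
  have "(norm (block P i x))\<^sup>2 = x \<bullet> block P i x" for i
    by (simp add: power2_norm_eq_inner inner_block_left block_block)
  then have "(\<Sum>i\<in>UNIV. (norm (block P i x))\<^sup>2) = x \<bullet> (\<Sum>i\<in>UNIV. block P i x)"
    by (simp add: inner_sum_right)
  then show ?thesis
    by (simp add: sum_block power2_norm_eq_inner)
qed

lemma norm_block_le_norm2inf: "norm (block P i x) \<le> norm2inf P x"
  unfolding norm2inf_def by (intro Max_ge) auto

lemma norm_le_norm2inf:
  fixes P :: "('n::finite, 'm::finite, 'a::finite) problem"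
  shows "norm x \<le> sqrt (real CARD('a)) * norm2inf P x"
proof -
  have nonneg: "0 \<le> norm2inf P x"
    using norm_block_le_norm2inf[of P undefined x] norm_ge_zero[of "block P undefined x"] by linarith
  have "(norm x)\<^sup>2 \<le> (\<Sum>i\<in>(UNIV::'a set). (norm2inf P x)\<^sup>2)"
    unfolding norm_power2_eq_sum_blocks[of x P]
    by (intro sum_mono power_mono norm_block_le_norm2inf) auto
  also have "\<dots> = (sqrt (real CARD('a)) * norm2inf P x)\<^sup>2"
    by (simp add: power_mult_distrib)
  finally show ?thesis
    by (rule power2_le_imp_le) (use nonneg in auto)
qed

lemma compact_feasible:
  assumes "standing_assumptions P"
  shows "compact (feasible P)"
proof -
  have loc: "closed (local_set P i)" "bounded (local_set P i)" for i
    using assms by (auto simp: standing_assumptions_def compact_imp_closed compact_imp_bounded)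
  have "closed (\<Inter>i. block P i -` local_set P i)"
    using bounded_linear_block by (intro closed_INT ballI closed_vimage loc)
      (auto intro: linear_continuous_on)
  moreover have "(\<Inter>i. block P i -` local_set P i) = feasible P"
    by (auto simp: feasible_def)
  ultimately have "closed (feasible P)" by simp
  moreover have "bounded (feasible P)"
  proof -
    have "\<exists>C. \<forall>y\<in>local_set P i. norm y \<le> C" for i
      using loc(2)[of i] by (auto simp: bounded_iff)
    then obtain C where C: "\<And>i y. y \<in> local_set P i \<Longrightarrow> norm y \<le> C i"
      by metis
    have "norm x \<le> (\<Sum>i\<in>UNIV. C i)" if "x \<in> feasible P" for x
    proof -
      have "norm x \<le> (\<Sum>i\<in>UNIV. norm (block P i x))"
        by (metis sum_block norm_sum)
      also have "\<dots> \<le> (\<Sum>i\<in>UNIV. C i)"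
        using that by (intro sum_mono C) (auto simp: feasible_def)
      finally show ?thesis .
    qed
    then show ?thesis by (auto simp: bounded_iff)
  qed
  ultimately show ?thesis
    by (simp add: compact_eq_bounded_closed)
qed

lemma convex_feasible:
  assumes "standing_assumptions P"
  shows "convex (feasible P)"
proof -
  have "convex (\<Inter>i. block P i -` local_set P i)"
    using assms by (intro convex_INT ballI convex_linear_vimage linear_block)
      (auto simp: standing_assumptions_def)
  moreover have "(\<Inter>i. block P i -` local_set P i) = feasible P"
    by (auto simp: feasible_def)
  ultimately show ?thesis by simp
qed

lemma norm2inf_feasible_le_L_x:
  assumes "standing_assumptions P" "x \<in> feasible P" "y \<in> feasible P"
  shows "norm2inf P (x - y) \<le> L_x P"
  unfolding norm2inf_def
proof (rule Max.boundedI; (safe)?)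
  fix i
  have "dist (block P i x) (block P i y) \<le> diameter (local_set P i)"
    using assms by (intro diameter_bounded_bound)
      (auto simp: standing_assumptions_def feasible_def compact_imp_bounded)
  also have "\<dots> \<le> L_x P"
    unfolding L_x_def by (intro Max_ge) auto
  finally show "norm (block P i (x - y)) \<le> L_x P"
    by (simp add: block_diff dist_norm)
qed auto

section \<open>Regularity of the Lagrangian\<close>

lemma C2_imp_differentiable: "C2 h \<Longrightarrow> h differentiable (at x)"
  unfolding C2_def differentiable_def by blast

lemma objective_differentiable:
  assumes "standing_assumptions P"
  shows "objective P differentiable (at x)"
proof -
  have "(\<lambda>x. coupling_cost P x + (\<Sum>i\<in>UNIV. local_cost P i (block P i x))) differentiable (at x)"
    using assms by (intro differentiable_add differentiable_sum ballI C2_imp_differentiable)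
      (auto simp: standing_assumptions_def)
  then show ?thesis by (simp add: objective_def[abs_def])
qed

lemma Lagr_differentiable:
  assumes "standing_assumptions P"
  shows "(\<lambda>x. Lagr P x \<mu>) differentiable (at x)"
proof -
  have "constr P differentiable (at x)"
    using assms by (auto simp: standing_assumptions_def intro: C2_imp_differentiable)
  then have "(\<lambda>x. \<mu> \<bullet> constr P x) differentiable (at x)"
    by (intro differentiable_inner) auto
  moreover have "(\<lambda>x. reg_p P / 2 * (norm x)\<^sup>2) differentiable (at x)" for x :: "real^'n"
    unfolding power2_norm_eq_inner
    by (intro differentiable_mult differentiable_inner) auto
  ultimately show ?thesis
    unfolding Lagr_def using objective_differentiable[OF assms]
    by (intro differentiable_diff differentiable_add) auto
qed

lemma convex_on_sum_fun:
  assumes "convex S" "\<And>i. i \<in> I \<Longrightarrow> convex_on S (h i)"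
  shows "convex_on S (\<lambda>x. \<Sum>i\<in>I. h i x)"
  using assms(2)
proof (induction I rule: infinite_finite_induct)
  case (insert i I)
  then show ?case by (auto intro: convex_on_add)
qed (use assms(1) in \<open>simp_all add: convex_on_const\<close>)

lemma convex_on_objective:
  assumes "standing_assumptions P"
  shows "convex_on UNIV (objective P)"
proof -
  have "convex_on UNIV (\<lambda>x. coupling_cost P x + (\<Sum>i\<in>UNIV. local_cost P i (block P i x)))"
    using assms by (intro convex_on_add convex_on_sum_fun) (auto simp: standing_assumptions_def)
  then show ?thesis by (simp add: objective_def[abs_def])
qed

lemma convex_on_inner_constr:
  assumes "standing_assumptions P" "\<mu> \<in> nonneg_orthant"
  shows "convex_on UNIV (\<lambda>x. \<mu> \<bullet> constr P x)"
  unfolding inner_vec_def inner_real_def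
  using assms by (intro convex_on_sum_fun convex_on_cmul)
    (auto simp: standing_assumptions_def nonneg_orthant_def)

text \<open>
  A supremum in the reals bounds its members only if it is taken over a bounded set; here this
  follows from continuity of the derivative and compactness.
\<close>

lemma C2_imp_lipschitz_SUP_onorm:
  fixes h :: "'a::euclidean_space \<Rightarrow> 'b::real_normed_vector"
  assumes "C2 h" "compact S" "convex S" "x \<in> S" "y \<in> S"
  defines "M \<equiv> SUP z\<in>S. onorm (frechet_derivative h (at z))"
  shows "norm (h x - h y) \<le> M * norm (x - y)" and "0 \<le> M"
proof -
  obtain h' h'' where h': "\<And>z. (h has_derivative blinfun_apply (h' z)) (at z)"
    and h'': "\<And>z. (h' has_derivative blinfun_apply (h'' z)) (at z)"
    using assms(1) unfolding C2_def by blast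
  have eq: "onorm (frechet_derivative h (at z)) = norm (h' z)" for z
    using frechet_derivative_at[OF h'[of z]] by (simp add: norm_blinfun.rep_eq)
  have "continuous_on S (\<lambda>z. norm (h' z))"
    by (intro continuous_on_norm continuous_at_imp_continuous_on ballI has_derivative_continuous[OF h''])
  then have "bdd_above ((\<lambda>z. norm (h' z)) ` S)"
    using assms(2) by (intro bounded_imp_bdd_above compact_imp_bounded compact_continuous_image)
  then have le: "norm (h' z) \<le> M" if "z \<in> S" for z
    unfolding M_def eq using that by (rule cSUP_upper[rotated])
  show "0 \<le> M"
    using le[OF assms(4)] norm_ge_zero[of "h' x"] by linarith
  show "norm (h x - h y) \<le> M * norm (x - y)"
  proof (rule differentiable_bound[OF assms(3)])
    show "(h has_derivative blinfun_apply (h' z)) (at z within S)" for z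
      using h' by (rule has_derivative_at_withinI)
    show "onorm (blinfun_apply (h' z)) \<le> M" if "z \<in> S" for z
      using le[OF that] by (simp add: norm_blinfun.rep_eq)
  qed (use assms in auto)
qed

lemma Lagr_attains_min:
  assumes "standing_assumptions P"
  shows "\<exists>x\<in>feasible P. \<forall>y\<in>feasible P. Lagr P x \<mu> \<le> Lagr P y \<mu>"
proof (rule continuous_attains_inf[OF compact_feasible[OF assms]])
  show "feasible P \<noteq> {}"
    using assms by (auto simp: standing_assumptions_def)
  show "continuous_on (feasible P) (\<lambda>x. Lagr P x \<mu>)"
    by (intro continuous_at_imp_continuous_on ballI differentiable_imp_continuous_within
        Lagr_differentiable assms)
qed

lemma x_hat_minimizes:
  assumes "standing_assumptions P"
  shows "x_hat P R t \<in> feasible P"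
    and "y \<in> feasible P \<Longrightarrow> Lagr P (x_hat P R t) (dual R t) \<le> Lagr P y (dual R t)"
proof -
  obtain x where "is_arg_min (\<lambda>x. Lagr P x (dual R t)) (\<lambda>x. x \<in> feasible P) x"
    using Lagr_attains_min[OF assms, of "dual R t"] by (auto simp: is_arg_min_linorder)
  then have "is_arg_min (\<lambda>x. Lagr P x (dual R t)) (\<lambda>x. x \<in> feasible P) (x_hat P R t)"
    unfolding x_hat_def arg_min_on_def arg_min_def by (rule someI)
  then show "x_hat P R t \<in> feasible P"
    and "y \<in> feasible P \<Longrightarrow> Lagr P (x_hat P R t) (dual R t) \<le> Lagr P y (dual R t)"
    by (auto simp: is_arg_min_linorder)
qed

section \<open>Strong convexity in the primal variable\<close>

lemma norm_power2_convex_combination: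
  fixes x y :: "'a::real_inner"
  shows "(norm ((1 - s) *\<^sub>R x + s *\<^sub>R y))\<^sup>2 =
    (1 - s) * (norm x)\<^sup>2 + s * (norm y)\<^sup>2 - s * (1 - s) * (norm (y - x))\<^sup>2"
  unfolding power2_norm_eq_inner
  by (simp add: inner_simps inner_commute algebra_simps power2_eq_square)

text \<open>
  Compare the minimum with the values on the segment from \<open>x\<close> to \<open>y\<close>, where the regularizer falls
  short of its chord by \<open>a/2 s (1 - s) \<parallel>y - x\<parallel>\<^sup>2\<close>; divide by the fraction \<open>s\<close> of the way that is
  travelled and let it tend to \<open>0\<close>. The lemma is applied to the primal minimization and, with the linear
  function \<open>\<mu> \<mapsto> - \<mu> \<bullet> g(xhat)\<close>, to the dual maximization.
\<close>

lemma regularized_min_quadratic_growth: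
  fixes x y :: "'a::real_inner"
  assumes h: "convex_on S h" and "x \<in> S" "y \<in> S"
    and min: "\<And>z. z \<in> S \<Longrightarrow> h x + a / 2 * (norm x)\<^sup>2 \<le> h z + a / 2 * (norm z)\<^sup>2"
  shows "h x + a / 2 * (norm x)\<^sup>2 + a / 2 * (norm (y - x))\<^sup>2 \<le> h y + a / 2 * (norm y)\<^sup>2"
proof -
  define F where "F z = h z + a / 2 * (norm z)\<^sup>2" for z
  have "(1 - s) * (a / 2 * (norm (y - x))\<^sup>2) \<le> F y - F x" if s: "0 < s" "s < 1" for s
  proof -
    define z where "z = (1 - s) *\<^sub>R x + s *\<^sub>R y"
    have "z \<in> S"
      using convexD_alt[OF convex_on_imp_convex[OF h] \<open>x \<in> S\<close> \<open>y \<in> S\<close>, of s] s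
      by (simp add: z_def)
    then have "F x \<le> h z + a / 2 * (norm z)\<^sup>2"
      unfolding F_def by (rule min)
    also have "h z \<le> (1 - s) * h x + s * h y"
      unfolding z_def using s assms by (intro convex_onD[OF h]) auto
    finally have "F x \<le> (1 - s) * h x + s * h y + a / 2 * (norm z)\<^sup>2" by simp
    then have "s * ((1 - s) * (a / 2 * (norm (y - x))\<^sup>2)) \<le> s * (F y - F x)"
      unfolding z_def norm_power2_convex_combination F_def
      by (simp add: algebra_simps add_divide_distrib diff_divide_distrib)
    then show ?thesis using s by simp
  qed
  from this[of "1 - s" for s] have "s * (a / 2 * (norm (y - x))\<^sup>2) \<le> F y - F x" if "0 < s" "s < 1" for s
    using that by simp
  then have "a / 2 * (norm (y - x))\<^sup>2 \<le> F y - F x"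
    by (rule field_le_mult_one_interval)
  then show ?thesis by (simp add: F_def)
qed

lemma Lagr_min_quadratic_growth:
  assumes "standing_assumptions P" "\<mu> \<in> nonneg_orthant"
    and "x \<in> feasible P" "y \<in> feasible P"
    and "\<And>z. z \<in> feasible P \<Longrightarrow> Lagr P x \<mu> \<le> Lagr P z \<mu>"
  shows "Lagr P x \<mu> + reg_p P / 2 * (norm (y - x))\<^sup>2 \<le> Lagr P y \<mu>"
proof -
  have "convex_on (feasible P) (\<lambda>x. objective P x + \<mu> \<bullet> constr P x)"
    using assms convex_feasible[of P]
    by (intro convex_on_subset[OF convex_on_add[OF convex_on_objective convex_on_inner_constr]]) auto
  from regularized_min_quadratic_growth[OF this assms(3,4), of "reg_p P"] assms(5)
  show ?thesis by (simp add: Lagr_def algebra_simps)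
qed

text \<open>
  Add the growth inequalities of the two minimizers, each evaluated at the other one. As the
  constraints are Lipschitz, this amounts to cocoercivity of the gradient of the dual function.
\<close>

lemma inner_constr_minimizers_ge:
  assumes "standing_assumptions P" "\<mu> \<in> nonneg_orthant" "\<mu>' \<in> nonneg_orthant"
    and "x \<in> feasible P" "\<And>z. z \<in> feasible P \<Longrightarrow> Lagr P x \<mu> \<le> Lagr P z \<mu>"
    and "x' \<in> feasible P" "\<And>z. z \<in> feasible P \<Longrightarrow> Lagr P x' \<mu>' \<le> Lagr P z \<mu>'"
  shows "reg_p P * (norm (x - x'))\<^sup>2 \<le> (\<mu> - \<mu>') \<bullet> (constr P x' - constr P x)"
proof -
  have "Lagr P x \<mu> + reg_p P / 2 * (norm (x' - x))\<^sup>2 \<le> Lagr P x' \<mu>"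
    using assms by (intro Lagr_min_quadratic_growth) auto
  moreover have "Lagr P x' \<mu>' + reg_p P / 2 * (norm (x - x'))\<^sup>2 \<le> Lagr P x \<mu>'"
    using assms by (intro Lagr_min_quadratic_growth) auto
  ultimately show ?thesis
    by (simp add: Lagr_def norm_minus_commute[of x' x] inner_simps)
qed

section \<open>The multiplier set and the saddle point\<close>

lemma norm_constr_diff_le:
  assumes "standing_assumptions P" "x \<in> feasible P" "y \<in> feasible P"
  shows "norm (constr P x - constr P y) \<le> M_g P * norm (x - y)" and "0 \<le> M_g P"
  using assms C2_imp_lipschitz_SUP_onorm[of "constr P" "feasible P" x y]
    compact_feasible[of P] convex_feasible[of P]
  unfolding M_g_def standing_assumptions_def by blast+

lemma convex_nonneg_orthant: "convex nonneg_orthant"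
  by (rule convexI) (simp add: nonneg_orthant_def)

lemma closed_dual_set: "closed (dual_set P)"
proof -
  have "closed {\<mu> :: real^'m. \<forall>j. 0 \<le> \<mu> $ j}"
    by (intro closed_Collect_all closed_Collect_le continuous_intros)
  moreover have "closed {\<mu> :: real^'m. (\<Sum>j\<in>UNIV. \<bar>\<mu> $ j\<bar>) \<le> C}" for C
    by (intro closed_Collect_le continuous_intros)
  ultimately show ?thesis
    unfolding dual_set_def nonneg_orthant_def mem_Collect_eq by (intro closed_Collect_conj)
qed

lemma convex_dual_set: "convex (dual_set P)"
proof -
  have "convex {\<mu> :: real^'m. (\<Sum>j\<in>UNIV. \<bar>\<mu> $ j\<bar>) \<le> C}" for C
  proof (rule convexI)
    fix \<mu> \<nu> :: "real^'m" and u v :: real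
    assume *: "\<mu> \<in> {\<mu>. (\<Sum>j\<in>UNIV. \<bar>\<mu> $ j\<bar>) \<le> C}" "\<nu> \<in> {\<mu>. (\<Sum>j\<in>UNIV. \<bar>\<mu> $ j\<bar>) \<le> C}"
      and uv: "0 \<le> u" "0 \<le> v" "u + v = 1"
    have "(\<Sum>j\<in>UNIV. \<bar>(u *\<^sub>R \<mu> + v *\<^sub>R \<nu>) $ j\<bar>) \<le> (\<Sum>j\<in>UNIV. u * \<bar>\<mu> $ j\<bar> + v * \<bar>\<nu> $ j\<bar>)"
    proof (rule sum_mono)
      fix j
      show "\<bar>(u *\<^sub>R \<mu> + v *\<^sub>R \<nu>) $ j\<bar> \<le> u * \<bar>\<mu> $ j\<bar> + v * \<bar>\<nu> $ j\<bar>"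
        using abs_triangle_ineq[of "u * \<mu> $ j" "v * \<nu> $ j"] uv by (simp add: abs_mult)
    qed
    also have "\<dots> = u * (\<Sum>j\<in>UNIV. \<bar>\<mu> $ j\<bar>) + v * (\<Sum>j\<in>UNIV. \<bar>\<nu> $ j\<bar>)"
      by (simp add: sum.distrib sum_distrib_left)
    also have "\<dots> \<le> C"
      using * uv by (intro convex_bound_le) auto
    finally show "u *\<^sub>R \<mu> + v *\<^sub>R \<nu> \<in> {\<mu>. (\<Sum>j\<in>UNIV. \<bar>\<mu> $ j\<bar>) \<le> C}" by simp
  qed
  then show ?thesis
    unfolding dual_set_def Collect_conj_eq Collect_mem_eq
    by (intro convex_Int convex_nonneg_orthant)
qed

text \<open>
  Comparing \<open>L(xhat, 0) \<le> L(xhat, muhat) \<le> L(slater, muhat)\<close> bounds \<open>- muhat \<bullet> g(slater)\<close>, and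
  all components of \<open>- g(slater)\<close> are bounded away from \<open>0\<close>.
\<close>

lemma saddle_point_multiplier_in_dual_set:
  fixes P :: "('n::finite, 'm::finite, 'a::finite) problem"
  assumes sa: "standing_assumptions P" and "0 \<le> reg_p P" "0 \<le> reg_d P"
    and saddle: "saddle_point P xhat muhat"
  shows "muhat \<in> dual_set P"
proof -
  let ?C = "objective P (slater P) + reg_p P / 2 * (norm (slater P))\<^sup>2 - Inf (objective P ` feasible P)"
  let ?m = "Min (range (\<lambda>j. - (constr P (slater P) $ j)))"
  have mu: "muhat \<in> nonneg_orthant" and xhat: "xhat \<in> feasible P"
    using saddle by (auto simp: saddle_point_def)
  have slater: "slater P \<in> feasible P" "\<And>j. constr P (slater P) $ j < 0"
    using sa by (auto simp: standing_assumptions_def)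
  have "0 \<in> (nonneg_orthant :: (real^'m) set)"
    by (simp add: nonneg_orthant_def)
  then have "Lagr P xhat 0 \<le> Lagr P (slater P) muhat"
    using saddle slater(1) unfolding saddle_point_def by (meson order_trans)
  moreover have "Inf (objective P ` feasible P) \<le> objective P xhat"
  proof (rule cInf_lower)
    have "continuous_on (feasible P) (objective P)"
      by (intro continuous_at_imp_continuous_on ballI differentiable_imp_continuous_within
          objective_differentiable sa)
    then show "bdd_below (objective P ` feasible P)"
      by (intro bounded_imp_bdd_below compact_imp_bounded compact_continuous_image compact_feasible sa)
  qed (use xhat in simp)
  moreover have "0 \<le> reg_p P / 2 * (norm xhat)\<^sup>2" "0 \<le> reg_d P / 2 * (norm muhat)\<^sup>2"
    using assms by simp_all
  ultimately have bound: "- (muhat \<bullet> constr P (slater P)) \<le> ?C"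
    unfolding Lagr_def by simp
  have "?m \<in> range (\<lambda>j. - (constr P (slater P) $ j))"
    by (intro Min_in) auto
  then have "0 < ?m" using slater(2) by auto
  moreover have "?m * (\<Sum>j\<in>UNIV. \<bar>muhat $ j\<bar>) \<le> - (muhat \<bullet> constr P (slater P))"
    unfolding inner_vec_def inner_real_def sum_distrib_left sum_negf[symmetric]
  proof (rule sum_mono)
    fix j
    have "?m \<le> - (constr P (slater P) $ j)" by (intro Min_le) auto
    then have "?m * (muhat $ j) \<le> - (constr P (slater P) $ j) * (muhat $ j)"
      using mu by (intro mult_right_mono) (auto simp: nonneg_orthant_def)
    then show "?m * \<bar>muhat $ j\<bar> \<le> - (muhat $ j * constr P (slater P) $ j)"
      using mu by (simp add: nonneg_orthant_def mult.commute)
  qed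
  ultimately have "(\<Sum>j\<in>UNIV. \<bar>muhat $ j\<bar>) \<le> ?C / ?m"
    using bound by (simp add: pos_le_divide_eq mult.commute[of _ "?m"])
  with mu show ?thesis by (simp add: dual_set_def)
qed

text \<open>
  The saddle point multiplier is stationary for the dual step taken at \<open>xhat\<close>: quadratic growth
  for the dual maximization is the variational inequality
  \<open>(g(xhat) - \<beta> muhat) \<bullet> (\<nu> - muhat) \<le> 0\<close>, which characterizes the projection.
\<close>

lemma saddle_point_multiplier_fixed_point:
  assumes sa: "standing_assumptions P" and "0 \<le> reg_p P" "0 \<le> reg_d P" "0 \<le> \<rho>"
    and saddle: "saddle_point P xhat muhat"
  shows "closest_point (dual_set P) (muhat + \<rho> *\<^sub>R (constr P xhat - reg_d P *\<^sub>R muhat)) = muhat"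
proof (rule closest_point_unique[OF convex_dual_set closed_dual_set, symmetric])
  show "muhat \<in> dual_set P"
    using assms by (intro saddle_point_multiplier_in_dual_set)
  define v where "v = constr P xhat - reg_d P *\<^sub>R muhat"
  show "\<forall>\<nu>\<in>dual_set P. dist (muhat + \<rho> *\<^sub>R v) muhat \<le> dist (muhat + \<rho> *\<^sub>R v) \<nu>"
  proof
    fix \<nu> assume "\<nu> \<in> dual_set P"
    then have \<nu>: "\<nu> \<in> nonneg_orthant" by (simp add: dual_set_def)
    have "- (muhat \<bullet> constr P xhat) + reg_d P / 2 * (norm muhat)\<^sup>2 + reg_d P / 2 * (norm (\<nu> - muhat))\<^sup>2
      \<le> - (\<nu> \<bullet> constr P xhat) + reg_d P / 2 * (norm \<nu>)\<^sup>2"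
    proof (rule regularized_min_quadratic_growth[OF _ _ \<nu>])
      show "convex_on nonneg_orthant (\<lambda>\<mu>. - (\<mu> \<bullet> constr P xhat))"
        by (rule convex_onI[OF _ convex_nonneg_orthant]) (simp add: inner_simps algebra_simps)
      show "muhat \<in> nonneg_orthant" using saddle by (simp add: saddle_point_def)
      show "- (muhat \<bullet> constr P xhat) + reg_d P / 2 * (norm muhat)\<^sup>2
        \<le> - (z \<bullet> constr P xhat) + reg_d P / 2 * (norm z)\<^sup>2" if "z \<in> nonneg_orthant" for z
      proof -
        have "Lagr P xhat z \<le> Lagr P xhat muhat"
          using saddle that unfolding saddle_point_def by blast
        then show ?thesis by (simp add: Lagr_def)
      qed
    qed
    then have "v \<bullet> (\<nu> - muhat) \<le> 0"
      unfolding v_def power2_norm_eq_inner by (simp add: inner_simps inner_commute algebra_simps)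
    then have "(\<rho> *\<^sub>R v) \<bullet> (\<nu> - muhat) \<le> 0"
      using \<open>0 \<le> \<rho>\<close> by (simp add: mult_nonneg_nonpos)
    then have "(\<rho> *\<^sub>R v) \<bullet> (\<rho> *\<^sub>R v) \<le> (\<rho> *\<^sub>R v - (\<nu> - muhat)) \<bullet> (\<rho> *\<^sub>R v - (\<nu> - muhat))"
      using inner_ge_zero[of "\<nu> - muhat"]
      unfolding inner_diff_left[of "\<rho> *\<^sub>R v"] inner_diff_right[of _ "\<rho> *\<^sub>R v"]
      by (simp only: inner_commute[of "\<nu> - muhat" "\<rho> *\<^sub>R v"])
    then have "norm (\<rho> *\<^sub>R v) \<le> norm (\<rho> *\<^sub>R v - (\<nu> - muhat))"
      unfolding norm_le .
    then show "dist (muhat + \<rho> *\<^sub>R v) muhat \<le> dist (muhat + \<rho> *\<^sub>R v) \<nu>"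
      by (simp add: dist_norm algebra_simps)
  qed
qed

lemma dual_in_dual_set:
  assumes run: "primal_dual_run P \<gamma> \<rho> R"
  shows "dual R t \<in> dual_set P"
proof -
  have 0: "dual R 0 \<in> dual_set P"
    using run unfolding primal_dual_run_def by blast
  show ?thesis
  proof (cases t)
    case (Suc s)
    then have "dual R t = closest_point (dual_set P)
      (dual R s + \<rho> *\<^sub>R (constr P (cloud_state P R s) - reg_d P *\<^sub>R dual R s))"
      using run unfolding primal_dual_run_def by blast
    then show ?thesis
      using closest_point_in_set[OF closed_dual_set] 0 by auto
  qed (use 0 in simp)
qed

section \<open>Gradient dependencies and essential neighbors\<close>

lemma GDERIV_gradient:
  fixes h :: "'a::euclidean_space \<Rightarrow> real"
  assumes "h differentiable (at x)"
  shows "GDERIV h x :> gradient h x"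
proof -
  obtain h' where h': "(h has_derivative h') (at x)"
    using assms by (auto simp: differentiable_def)
  have "h' = (\<lambda>v. v \<bullet> adjoint h' 1)"
    using adjoint_works[OF has_derivative_linear[OF h'], of _ 1] by (intro ext) simp
  with h' have G: "GDERIV h x :> adjoint h' 1"
    unfolding gderiv_def by (rule back_subst[where P = "\<lambda>d. (h has_derivative d) (at x)"])
  have "D = adjoint h' 1" if "GDERIV h x :> D" for D
  proof -
    have "(\<lambda>v. v \<bullet> D) = (\<lambda>v. v \<bullet> adjoint h' 1)"
      using that G unfolding gderiv_def by (rule has_derivative_unique)
    then have "v \<bullet> D = v \<bullet> adjoint h' 1" for v by (rule fun_cong)
    then show ?thesis by (metis vector_eq_ldot)
  qed
  with G show ?thesis unfolding gradient_def by (rule theI)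
qed

lemma Lagr_has_real_derivative_line:
  assumes "standing_assumptions P"
  shows "((\<lambda>s. Lagr P (x + s *\<^sub>R u) \<mu>) has_real_derivative u \<bullet> grad_x P (x + s *\<^sub>R u) \<mu>) (at s)"
proof -
  let ?g = "\<lambda>s. x + s *\<^sub>R u"
  have "((\<lambda>y. Lagr P y \<mu>) has_derivative (\<lambda>v. v \<bullet> grad_x P (?g s) \<mu>)) (at (?g s))"
    using GDERIV_gradient[OF Lagr_differentiable[OF assms]] unfolding grad_x_def gderiv_def .
  moreover have "(?g has_derivative (\<lambda>r. r *\<^sub>R u)) (at s)"
    by (auto intro!: derivative_eq_intros)
  ultimately have "((\<lambda>s. Lagr P (?g s) \<mu>) has_derivative (\<lambda>r. (r *\<^sub>R u) \<bullet> grad_x P (?g s) \<mu>)) (at s)"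
    by (rule has_derivative_compose[rotated])
  then show ?thesis
    by (simp add: has_field_derivative_def mult.commute[of _ "u \<bullet> _"])
qed

lemma block_grad_eq_if_not_neighbor:
  assumes "j \<notin> neighbors P i" "j \<noteq> i" "\<mu> \<in> nonneg_orthant"
    and "\<And>l. l \<noteq> i \<Longrightarrow> block P l x = block P l y"
  shows "block P j (grad_x P x \<mu>) = block P j (grad_x P y \<mu>)"
  using assms unfolding neighbors_def by blast

text \<open>
  This reflects the symmetry of mixed second derivatives, but first derivatives suffice:
  if \<open>\<nabla>\<^sub>i\<close> ignores the \<open>j\<close>-th block, then for \<open>u\<close> in the \<open>i\<close>-th and \<open>v\<close> in the \<open>j\<close>-th block the mixed difference
  \<open>L(x + u + rv) - L(x + rv) - L(x + u) + L(x)\<close> vanishes, and differentiating it with respect to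
  \<open>r\<close> at \<open>0\<close> shows that \<open>\<nabla>\<^sub>j\<close> ignores the \<open>i\<close>-th block.
\<close>

lemma neighbors_sym:
  assumes sa: "standing_assumptions P" and ji: "j \<in> neighbors P i"
  shows "i \<in> neighbors P j"
proof (rule ccontr)
  assume notin: "i \<notin> neighbors P j"
  from ji obtain \<mu> x y where "j \<noteq> i" and \<mu>: "\<mu> \<in> nonneg_orthant"
    and xy: "\<And>l. l \<noteq> i \<Longrightarrow> block P l x = block P l y"
    and neq: "block P j (grad_x P x \<mu>) \<noteq> block P j (grad_x P y \<mu>)"
    unfolding neighbors_def by auto
  define u where "u = y - x"
  have u: "block P i u = u"
  proof (rule eq_if_blocks_eq[of P])
    fix l show "block P l (block P i u) = block P l u"
      using xy[of l] by (cases "l = i") (simp_all add: block_block u_def block_diff)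
  qed
  let ?L = "\<lambda>x. Lagr P x \<mu>"
  let ?G = "\<lambda>x. grad_x P x \<mu>"
  have "block P j (?G y) \<bullet> v = block P j (?G x) \<bullet> v" for v
  proof -
    define w where "w = block P j v"
    have flat: "?L (x + r *\<^sub>R w + u) - ?L (x + u) = ?L (x + r *\<^sub>R w) - ?L x" for r
    proof -
      let ?\<phi> = "\<lambda>s. ?L (x + r *\<^sub>R w + s *\<^sub>R u) - ?L (x + s *\<^sub>R u)"
      have "(?\<phi> has_real_derivative 0) (at s)" for s
      proof -
        have "block P i (?G (x + r *\<^sub>R w + s *\<^sub>R u)) = block P i (?G (x + s *\<^sub>R u))"
          by (rule block_grad_eq_if_not_neighbor[OF notin])
            (use \<open>j \<noteq> i\<close> \<mu> in \<open>auto simp: block_add block_scaleR w_def block_block\<close>)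
        then have "u \<bullet> ?G (x + r *\<^sub>R w + s *\<^sub>R u) = u \<bullet> ?G (x + s *\<^sub>R u)"
          by (metis u inner_block_left)
        then show ?thesis
          using DERIV_diff[OF Lagr_has_real_derivative_line[OF sa, of "x + r *\<^sub>R w" u \<mu> s]
              Lagr_has_real_derivative_line[OF sa, of x u \<mu> s]] by simp
      qed
      then have "?\<phi> 1 = ?\<phi> 0" by (intro DERIV_isconst_all allI)
      then show ?thesis by simp
    qed
    let ?\<psi> = "\<lambda>r. ?L (x + u + r *\<^sub>R w) - ?L (x + r *\<^sub>R w)"
    have "?\<psi> = (\<lambda>r. ?L (x + u) - ?L x)"
    proof
      fix r
      have "x + u + r *\<^sub>R w = x + r *\<^sub>R w + u" by simp
      with flat[of r] show "?\<psi> r = ?L (x + u) - ?L x" by (simp only:)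
    qed
    then have "(?\<psi> has_real_derivative 0) (at 0)" by simp
    moreover have "(?\<psi> has_real_derivative w \<bullet> ?G (x + u) - w \<bullet> ?G x) (at 0)"
      using DERIV_diff[OF Lagr_has_real_derivative_line[OF sa, of "x + u" w \<mu> 0]
          Lagr_has_real_derivative_line[OF sa, of x w \<mu> 0]] by simp
    ultimately have "w \<bullet> ?G (x + u) = w \<bullet> ?G x"
      using DERIV_unique by fastforce
    then show ?thesis
      by (simp add: u_def w_def inner_block_left inner_commute[of _ v])
  qed
  then have "block P j (?G y) = block P j (?G x)"
    by (metis vector_eq_rdot)
  with neq show False by simp
qed

text \<open>
  \<open>neighbors\<close> speaks of changing a single block; changing the irrelevant blocks one at a time gives
  the same for all of them together.
\<close>

lemma block_grad_cong:
  assumes \<mu>: "\<mu> \<in> nonneg_orthant"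
    and eq: "\<And>l. l = i \<or> i \<in> neighbors P l \<Longrightarrow> block P l x = block P l y"
  shows "block P i (grad_x P x \<mu>) = block P i (grad_x P y \<mu>)"
proof -
  define z where "z S = (\<Sum>l\<in>UNIV. block P l (if l \<in> S then y else x))" for S
  have z: "block P l (z S) = block P l (if l \<in> S then y else x)" for l S
    unfolding z_def by (rule block_sum_blocks)
  have "block P i (grad_x P (z S) \<mu>) = block P i (grad_x P x \<mu>)"
    if "finite S" "S \<subseteq> {l. l \<noteq> i \<and> i \<notin> neighbors P l}" for S
    using that
  proof (induction S)
    case empty
    have "z {} = x" by (simp add: z_def sum_block)
    then show ?case by simp
  next
    case (insert l S)
    have "block P i (grad_x P (z (insert l S)) \<mu>) = block P i (grad_x P (z S) \<mu>)"
      by (rule block_grad_eq_if_not_neighbor[of i P l]) (use insert.prems \<mu> in \<open>auto simp: z\<close>)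
    with insert show ?case by simp
  qed
  moreover have "z {l. l \<noteq> i \<and> i \<notin> neighbors P l} = y"
    by (rule eq_if_blocks_eq[of P]) (use eq in \<open>auto simp: z\<close>)
  ultimately show ?thesis
    by (metis finite_code order_refl)
qed

section \<open>The asynchronous primal iteration\<close>

lemma stamp_0: "stamp R j 0 = 0"
proof -
  have "{l. l \<le> 0 \<and> (l = 0 \<or> l - 1 \<in> update_times R j)} = {0::nat}" by auto
  then show ?thesis unfolding stamp_def by simp
qed

lemma stamp_Suc: "stamp R j (Suc k) = (if k \<in> update_times R j then Suc k else stamp R j k)"
proof (cases "k \<in> update_times R j")
  case True
  then show ?thesis unfolding stamp_def by (auto intro!: Max_eqI)
next
  case False
  then have "{l. l \<le> Suc k \<and> (l = 0 \<or> l - 1 \<in> update_times R j)} =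
    {l. l \<le> k \<and> (l = 0 \<or> l - 1 \<in> update_times R j)}"
    by (auto simp: le_Suc_eq)
  with False show ?thesis unfolding stamp_def by simp
qed

lemma stamp_le: "stamp R j k \<le> k"
  by (induction k) (auto simp: stamp_0 stamp_Suc)

text \<open>
  A time stamp is either the initial \<open>0\<close> or was brought by a message. This turns the growth of
  \<open>tau\<close> into the existence of messages, as a cycle demands.
\<close>

lemma tau_pos_imp_received:
  "0 < tau R i j k \<Longrightarrow> \<exists>r\<le>k. received R i j r \<and> tau R i j r = tau R i j k"
proof (induction k)
  case (Suc k)
  show ?case
  proof (cases "received R i j (Suc k)")
    case False
    then have "tau R i j (Suc k) = tau R i j k" by simp
    with Suc show ?thesis by (metis le_SucI)
  qed blast
qed simp

locale asynchronous_run =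
  fixes P :: "('n::finite, 'm::finite, 'a::finite) problem"
    and R :: "('n, 'm, 'a) run" and \<gamma> \<rho> :: real
  assumes standing: "standing_assumptions P"
    and run: "primal_dual_run P \<gamma> \<rho> R"
    and timing: "timing_requirements P R"
    and X_props: "\<And>t. X_set_properties P \<gamma> R t"
begin

lemma dual_nonneg: "dual R t \<in> nonneg_orthant"
  using dual_in_dual_set[OF run] by (simp add: dual_set_def)

lemma switch_mono: "strict_mono (switch R)"
  and switch_0: "switch R 0 = 0"
  using timing by (auto simp: timing_requirements_def)

lemma exists_epoch: "\<exists>t. switch R t \<le> k \<and> k < switch R (Suc t)"
proof (induction k)
  case 0
  then show ?case using switch_0 strict_monoD[OF switch_mono, of 0 1] by auto
next
  case (Suc k)
  then obtain t where t: "switch R t \<le> k" "k < switch R (Suc t)" by blast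
  show ?case
  proof (cases "Suc k < switch R (Suc t)")
    case True
    with t show ?thesis by (intro exI[of _ t]) auto
  next
    case False
    with t strict_monoD[OF switch_mono, of "Suc t" "Suc (Suc t)"] show ?thesis
      by (intro exI[of _ "Suc t"]) auto
  qed
qed

lemma own_block_Suc:
  assumes "switch R t \<le> k" "k < switch R (Suc t)"
  shows "block P i (state R i (Suc k)) =
    (if k \<in> update_times R i
     then closest_point (local_set P i)
       (block P i (state R i k) - \<gamma> *\<^sub>R block P i (grad_x P (state R i k) (dual R t)))
     else block P i (state R i k))"
  using run assms unfolding primal_dual_run_def by blast

lemma received_imp:
  assumes "received R i j k"
  shows "i \<in> neighbors P j" "sent R i j k \<le> k" "j \<noteq> i"
  using timing assms unfolding timing_requirements_def neighbors_def by blast+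

lemma own_block_stamp:
  "block P j (state R j (stamp R j k)) = block P j (state R j k)"
proof (induction k)
  case (Suc k)
  obtain t where "switch R t \<le> k" "k < switch R (Suc t)"
    using exists_epoch by blast
  from own_block_Suc[OF this, of j] Suc show ?case by (simp add: stamp_Suc)
qed (simp add: stamp_0)

text \<open>
  A message carries the block that was computed at its time stamp, but this is also the block held
  at the time of sending. Sending times are easier to use: they lie in the epoch of the message,
  while the time stamp may precede it.
\<close>

lemma other_block_Suc:
  assumes "j \<noteq> i"
  shows "block P j (state R i (Suc k)) =
    (if received R i j (Suc k) then block P j (state R j (sent R i j (Suc k)))
     else block P j (state R i k))"
proof -
  have "block P j (state R i (Suc k)) =
    (if received R i j (Suc k) then block P j (state R j (tau R i j (Suc k)))
     else block P j (state R i k))"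
    using run assms unfolding primal_dual_run_def by blast
  then show ?thesis by (simp add: own_block_stamp)
qed

text \<open>Messages expire with their epoch, so one that is used at time \<open>k\<close> stems from the epoch of \<open>k\<close>.\<close>

lemma sent_ge_switch:
  assumes "received R i j k" "switch R t \<le> k"
  shows "switch R t \<le> sent R i j k"
proof (rule ccontr)
  assume less: "\<not> switch R t \<le> sent R i j k"
  obtain t' where t': "switch R t' \<le> sent R i j k" "sent R i j k < switch R (Suc t')"
    using exists_epoch by blast
  then have "k < switch R (Suc t')"
    using timing assms(1) unfolding timing_requirements_def by blast
  moreover have "t' < t"
    using t' less strict_mono_less[OF switch_mono, of t' t] by linarith
  then have "switch R (Suc t') \<le> switch R t"
    using strict_mono_less_eq[OF switch_mono] by simp
  ultimately show False using assms(2) by simp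
qed

lemma state_feasible: "state R i k \<in> feasible P"
proof -
  have loc: "closed (local_set P j)" "local_set P j \<noteq> {}" for j
    using standing by (auto simp: standing_assumptions_def compact_imp_closed)
  have "\<forall>i j. block P j (state R i k) \<in> local_set P j"
  proof (induction k rule: less_induct)
    case (less k)
    show ?case
    proof (cases k)
      case 0
      obtain x0 where "x0 \<in> feasible P" "\<forall>i. state R i 0 = x0"
        using run unfolding primal_dual_run_def by blast
      with 0 show ?thesis by (auto simp: feasible_def)
    next
      case (Suc k')
      obtain t where t: "switch R t \<le> k'" "k' < switch R (Suc t)"
        using exists_epoch by blast
      have own: "block P j (state R j k) \<in> local_set P j" for j
        using own_block_Suc[OF t, of j] less[of k'] closest_point_in_set[OF loc] by (auto simp: Suc)
      have "block P j (state R j s) \<in> local_set P j" if "s \<le> k" for j s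
        using that own less[of s] by (cases "s = k") auto
      moreover have "sent R i j k \<le> k" if "received R i j k" for i j
        using received_imp that by blast
      ultimately have "block P j (state R i k) \<in> local_set P j" if "j \<noteq> i" for i j
        using other_block_Suc[OF that, of k'] less[of k'] by (auto simp: Suc)
      with own show ?thesis by metis
    qed
  qed
  then show ?thesis by (simp add: feasible_def)
qed

text \<open>
  The nested-box property only asserts the existence of factors for each \<open>X_set\<close>. The projections
  of \<open>X_set\<close> are a canonical choice of factors, and inherit monotonicity in the level.
\<close>

definition X_block :: "nat \<Rightarrow> 'a \<Rightarrow> nat \<Rightarrow> (real^'n) set" where
  "X_block t i s = block P i ` X_set P \<gamma> R t s"

lemma X_set_antimono: "s \<le> s' \<Longrightarrow> X_set P \<gamma> R t s' \<subseteq> X_set P \<gamma> R t s"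
  by (erule lift_Suc_antimono_le[rotated]) (use X_props[of t] in \<open>auto simp: X_set_properties_def\<close>)

lemma X_block_antimono: "s \<le> s' \<Longrightarrow> X_block t i s' \<subseteq> X_block t i s"
  unfolding X_block_def using X_set_antimono by (rule image_mono)

lemma x_hat_in_X_set: "x_hat P R t \<in> X_set P \<gamma> R t s"
proof -
  have "x_hat P R t \<in> liminf (X_set P \<gamma> R t)"
    using X_props[of t] unfolding X_set_properties_def by simp
  then obtain n where n: "\<And>m. m \<ge> n \<Longrightarrow> x_hat P R t \<in> X_set P \<gamma> R t m"
    unfolding liminf_SUP_INF by auto
  from n[of "max n s"] X_set_antimono[of s "max n s" t] show ?thesis by auto
qed

lemma X_set_product:
  "\<exists>B. (\<forall>i s. B i s \<subseteq> local_set P i) \<and>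
    (\<forall>s y. y \<in> X_set P \<gamma> R t s \<longleftrightarrow> (\<forall>i. block P i y \<in> B i s)) \<and>
    (\<forall>s. \<forall>y\<in>X_set P \<gamma> R t s. \<forall>i.
       closest_point (local_set P i) (block P i y - \<gamma> *\<^sub>R block P i (grad_x P y (dual R t)))
         \<in> B i (Suc s))"
proof -
  have "\<exists>B. (\<forall>i s. B i s \<subseteq> local_set P i) \<and>
    (\<forall>s. X_set P \<gamma> R t s = {y. \<forall>i. block P i y \<in> B i s}) \<and>
    (\<forall>s. \<forall>y\<in>X_set P \<gamma> R t s. \<forall>i.
       closest_point (local_set P i) (block P i y - \<gamma> *\<^sub>R block P i (grad_x P y (dual R t)))
         \<in> B i (Suc s))"
    using X_props[of t] unfolding X_set_properties_def by (elim conjE)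
  then show ?thesis
    unfolding set_eq_iff mem_Collect_eq .
qed

lemma X_set_iff_blocks: "y \<in> X_set P \<gamma> R t s \<longleftrightarrow> (\<forall>i. block P i y \<in> X_block t i s)"
proof
  assume *: "\<forall>i. block P i y \<in> X_block t i s"
  obtain B where B: "\<forall>s y. y \<in> X_set P \<gamma> R t s \<longleftrightarrow> (\<forall>i. block P i y \<in> B i s)"
    using X_set_product[of t] by (elim exE conjE)
  have "block P i y \<in> B i s" for i
  proof -
    obtain y' where "block P i y = block P i y'" "y' \<in> X_set P \<gamma> R t s"
      using spec[OF *, of i] unfolding X_block_def by (rule imageE)
    then show ?thesis using B[rule_format, of y' s] by simp
  qed
  then show "y \<in> X_set P \<gamma> R t s" using B[rule_format, of y s] by simp
qed (simp add: X_block_def)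

text \<open>
  One projected gradient step of agent \<open>i\<close> gains a level as soon as the blocks that influence it
  are in the current level. The remaining blocks, of which agent \<open>i\<close> never hears, may be far
  away; replacing them by those of the minimizer does not change the step.
\<close>

lemma update_in_X_block:
  assumes y: "\<And>j. j = i \<or> i \<in> neighbors P j \<Longrightarrow> block P j y \<in> X_block t j s"
  shows "closest_point (local_set P i) (block P i y - \<gamma> *\<^sub>R block P i (grad_x P y (dual R t)))
           \<in> X_block t i (Suc s)" (is "?z \<in> _")
proof -
  obtain B where B1: "\<forall>i s. B i s \<subseteq> local_set P i"
    and B2: "\<forall>s y. y \<in> X_set P \<gamma> R t s \<longleftrightarrow> (\<forall>i. block P i y \<in> B i s)"
    and B3: "\<forall>s. \<forall>y\<in>X_set P \<gamma> R t s. \<forall>i.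
       closest_point (local_set P i) (block P i y - \<gamma> *\<^sub>R block P i (grad_x P y (dual R t)))
         \<in> B i (Suc s)"
    using X_set_product[of t] by (elim exE conjE)
  note B2 = B2[rule_format]
  define y' where
    "y' = (\<Sum>j\<in>UNIV. block P j (if j = i \<or> i \<in> neighbors P j then y else x_hat P R t))"
  have y'_block: "block P j y' = block P j (if j = i \<or> i \<in> neighbors P j then y else x_hat P R t)" for j
    unfolding y'_def by (rule block_sum_blocks)
  have "y' \<in> X_set P \<gamma> R t s"
    unfolding X_set_iff_blocks using y x_hat_in_X_set by (auto simp: y'_block X_block_def)
  moreover have "block P i (grad_x P y (dual R t)) = block P i (grad_x P y' (dual R t))"
    by (rule block_grad_cong[OF dual_nonneg]) (auto simp: y'_block)
  ultimately have z: "?z \<in> B i (Suc s)"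
    using B3[rule_format, of y' s i] by (simp add: y'_block)
  then obtain v where v: "?z = block P i v"
    using B1 standing unfolding standing_assumptions_def by blast
  define w where "w = (\<Sum>j\<in>UNIV. block P j (if j = i then v else x_hat P R t))"
  have w: "block P j w = (if j = i then ?z else block P j (x_hat P R t))" for j
    unfolding w_def block_sum_blocks by (simp add: v)
  have "w \<in> X_set P \<gamma> R t (Suc s)"
    using z x_hat_in_X_set[of t "Suc s"] unfolding B2 by (auto simp: w)
  then show ?thesis
    unfolding X_block_def by (rule image_eqI[rotated]) (simp add: w)
qed

text \<open>
  The invariant of the cycle argument. It covers the own blocks and the copies held by essential
  neighbors; the other copies are never refreshed and do not improve.
\<close>

definition informed :: "nat \<Rightarrow> nat \<Rightarrow> nat \<Rightarrow> bool" where
  "informed t s k \<longleftrightarrow>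
     (\<forall>i j. j = i \<or> i \<in> neighbors P j \<longrightarrow> block P j (state R i k) \<in> X_block t j s)"

lemma own_block_Suc_in_X_block:
  assumes "informed t s k" "k \<in> update_times R i" "switch R t \<le> k" "k < switch R (Suc t)"
  shows "block P i (state R i (Suc k)) \<in> X_block t i (Suc s)"
  unfolding own_block_Suc[OF assms(3,4)] if_P[OF assms(2)]
  by (rule update_in_X_block) (use assms(1) in \<open>auto simp: informed_def\<close>)

text \<open>
  Within an epoch no block leaves the initial box: updates move it to a smaller box, and messages
  from the same epoch only copy blocks that were in the box when they were sent.
\<close>

lemma informed_0:
  assumes "switch R t \<le> k" "k \<le> switch R (Suc t)"
  shows "informed t 0 k"
  using assms
proof (induction k rule: less_induct)
  case (less k)
  show ?case
  proof (cases "k = switch R t")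
    case True
    have "norm2inf P (state R i k - x_hat P R t) \<le> D_switch P R t" for i
      unfolding D_switch_def True by (intro Max_ge) auto
    then have "state R i k \<in> X_set P \<gamma> R t 0" for i
      by (simp add: X_set_def state_feasible)
    then show ?thesis by (auto simp: informed_def X_set_iff_blocks)
  next
    case False
    with less.prems obtain k' where k': "k = Suc k'" "switch R t \<le> k'" "k' < switch R (Suc t)"
      by (cases k) auto
    then have inf: "informed t 0 k'" by (intro less.IH) auto
    have own: "block P i (state R i k) \<in> X_block t i 0" for i
    proof (cases "k' \<in> update_times R i")
      case True
      then show ?thesis
        using own_block_Suc_in_X_block[OF inf True k'(2,3)] X_block_antimono[of 0 "Suc 0" t i]
        by (auto simp: k'(1))
    next
      case False
      then show ?thesis
        using own_block_Suc[OF k'(2,3), of i] inf by (simp add: k'(1) informed_def)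
    qed
    have "block P j (state R i k) \<in> X_block t j 0" if ij: "i \<in> neighbors P j" for i j
    proof (cases "received R i j k")
      case True
      note rec = received_imp[OF True] sent_ge_switch[OF True less.prems(1)]
      have "block P j (state R j (sent R i j k)) \<in> X_block t j 0"
        using less.IH[of "sent R i j k"] less.prems rec own[of j]
        by (cases "sent R i j k = k") (auto simp: informed_def)
      then show ?thesis
        using other_block_Suc[OF rec(3), of k'] True by (simp add: k'(1))
    next
      case False
      have "j \<noteq> i" using ij by (auto simp: neighbors_def)
      from other_block_Suc[OF this, of k'] False ij inf show ?thesis
        by (simp add: k'(1) informed_def)
    qed
    with own show ?thesis by (auto simp: informed_def)
  qed
qed

text \<open>
  The first update reaches the next level because it starts from an informed state, and so do all
  later updates in the epoch; no update can therefore leave that level again.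
\<close>

lemma own_block_after_update:
  assumes inf: "\<And>k. e \<le> k \<Longrightarrow> k \<le> switch R (Suc t) \<Longrightarrow> informed t s k"
    and "switch R t \<le> e" "e \<le> l" "l \<in> update_times R j" "Suc l \<le> k" "k \<le> switch R (Suc t)"
  shows "block P j (state R j k) \<in> X_block t j (Suc s)"
  using assms(5,6)
proof (induction k rule: dec_induct)
  case base
  then show ?case using assms by (intro own_block_Suc_in_X_block inf) auto
next
  case (step k)
  have k: "informed t s k" "switch R t \<le> k" "k < switch R (Suc t)"
    using step assms by (auto intro: inf)
  show ?case
  proof (cases "k \<in> update_times R j")
    case True
    then show ?thesis using k by (intro own_block_Suc_in_X_block)
  next
    case False
    then show ?thesis using own_block_Suc[OF k(2,3), of j] step by simp
  qed
qed

text \<open>Messages never overtake each other, so a copy can only be replaced by a newer one.\<close>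

lemma copy_after_receipt:
  assumes "received R i j r" "l \<le> tau R i j r" "0 < l" "r \<le> k"
  shows "\<exists>s. l \<le> s \<and> s \<le> k \<and> block P j (state R i k) = block P j (state R j s)"
  using assms(4)
proof (induction k rule: dec_induct)
  case base
  obtain r' where r': "r = Suc r'" using assms by (cases r) auto
  have "l \<le> sent R i j r"
    using assms(1,2) stamp_le[of R j "sent R i j r"] by (simp add: r')
  moreover have "block P j (state R i r) = block P j (state R j (sent R i j r))"
    using other_block_Suc[OF received_imp(3)[OF assms(1)], of r'] assms(1) by (simp add: r')
  ultimately show ?case using received_imp(2)[OF assms(1)] by blast
next
  case (step k)
  show ?case
  proof (cases "received R i j (Suc k)")
    case True
    obtain r' where r': "r = Suc r'" using assms by (cases r) auto
    have "l \<le> sent R i j r"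
      using assms(1,2) stamp_le[of R j "sent R i j r"] by (simp add: r')
    also have "\<dots> \<le> sent R i j (Suc k)"
      using timing assms(1) True step.hyps(1) unfolding timing_requirements_def
      by (meson le_imp_less_Suc)
    finally show ?thesis
      using other_block_Suc[OF received_imp(3)[OF True], of k] True received_imp(2)[OF True] by auto
  next
    case False
    then have "block P j (state R i (Suc k)) = block P j (state R i k)"
      using other_block_Suc[OF received_imp(3)[OF assms(1)], of k] by simp
    with step.IH show ?thesis by (metis le_SucI)
  qed
qed

text \<open>
  The end of a cycle is defined as a least element, which is meaningful only because every cycle
  ends eventually.
\<close>

lemma exists_cycle_complete: "\<exists>e'. cycle_complete P R e e'"
proof -
  have "\<exists>e'. \<exists>l\<in>update_times R j. e \<le> l \<and> l < e' \<and>
    (\<forall>i\<in>neighbors P j. \<exists>r\<le>e'. received R i j r \<and> Suc l \<le> tau R i j r)" for j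
  proof -
    have "infinite (update_times R j)" using timing by (auto simp: timing_requirements_def)
    then obtain l where l: "l \<in> update_times R j" "e \<le> l"
      unfolding infinite_nat_iff_unbounded_le by blast
    have "\<exists>r. i \<in> neighbors P j \<longrightarrow> received R i j r \<and> Suc l \<le> tau R i j r" for i
    proof (cases "i \<in> neighbors P j")
      case True
      \<comment> \<open>the timing requirement speaks of the senders in \<open>neighbors P i\<close>, a cycle of the
        receivers in \<open>neighbors P j\<close>\<close>
      then have ji: "j \<in> neighbors P i" by (rule neighbors_sym[OF standing])
      have inf: "infinite (update_times R i)" using timing by (auto simp: timing_requirements_def)
      define \<kappa> where "\<kappa> = enumerate (update_times R i)"
      have "\<forall>d. \<kappa> d \<in> update_times R i" "filterlim \<kappa> at_top sequentially"
        unfolding \<kappa>_def using inf by (auto intro: enumerate_in_set filterlim_subseq strict_mono_enumerate)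
      then have "filterlim (\<lambda>d. tau R i j (\<kappa> d)) at_top sequentially"
        using timing ji unfolding timing_requirements_def by blast
      then obtain d where d: "Suc l \<le> tau R i j (\<kappa> d)"
        unfolding filterlim_at_top using eventually_happens'[OF sequentially_bot] by blast
      then obtain r where "received R i j r" "tau R i j r = tau R i j (\<kappa> d)"
        using tau_pos_imp_received[of R i j "\<kappa> d"] by auto
      with d show ?thesis by auto
    qed auto
    then obtain r where r: "\<And>i. i \<in> neighbors P j \<Longrightarrow> received R i j (r i) \<and> Suc l \<le> tau R i j (r i)"
      by metis
    have "r i \<le> Suc l + (\<Sum>i\<in>UNIV. r i)" for i
      using member_le_sum[of i UNIV r] by simp
    with l r show ?thesis
      by (intro exI[of _ "Suc l + (\<Sum>i\<in>UNIV. r i)"] bexI[of _ l]) auto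
  qed
  then obtain e' where e': "\<And>j. \<exists>l\<in>update_times R j. e \<le> l \<and> l < e' j \<and>
    (\<forall>i\<in>neighbors P j. \<exists>r\<le>e' j. received R i j r \<and> Suc l \<le> tau R i j r)"
    by metis
  have "e' j \<le> (\<Sum>j\<in>UNIV. e' j)" for j
    using member_le_sum[of j UNIV e'] by simp
  with e' have "cycle_complete P R e (\<Sum>j\<in>UNIV. e' j)"
    unfolding cycle_complete_def by (meson order_less_le_trans order_trans)
  then show ?thesis ..
qed

lemma cycle_complete_cycle_end:
  "cycle_complete P R (cycle_end P R t n) (cycle_end P R t (Suc n))"
  unfolding cycle_end.simps(2) using exists_cycle_complete by (rule LeastI_ex)

lemma strict_mono_cycle_end: "strict_mono (cycle_end P R t)"
  unfolding strict_mono_Suc_iff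
proof
  fix n show "cycle_end P R t n < cycle_end P R t (Suc n)"
    using cycle_complete_cycle_end[of t n] unfolding cycle_complete_def by (meson order_le_less_trans)
qed

text \<open>
  Each completed cycle gains one level. During it, every agent updates from informed states, so its
  own block reaches the next level and stays there; and every neighbor receives such a block, after
  which its copy can only be replaced by a still newer one.
\<close>

lemma informed_after_cycles:
  assumes "cycle_end P R t n \<le> k" "k \<le> switch R (Suc t)"
  shows "informed t n k"
  using assms
proof (induction n arbitrary: k)
  case 0
  then show ?case by (intro informed_0) auto
next
  case (Suc n)
  let ?e = "cycle_end P R t n"
  have start: "switch R t \<le> ?e"
    using strict_mono_less_eq[OF strict_mono_cycle_end, of t 0 n] by simp
  show ?case
    unfolding informed_def
  proof (intro allI impI)
    fix i j assume ij: "j = i \<or> i \<in> neighbors P j"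
    obtain l where l: "l \<in> update_times R j" "?e \<le> l" "l < cycle_end P R t (Suc n)"
      and rec: "\<And>i. i \<in> neighbors P j \<Longrightarrow>
        \<exists>r\<le>cycle_end P R t (Suc n). received R i j r \<and> Suc l \<le> tau R i j r"
      using cycle_complete_cycle_end[of t n] unfolding cycle_complete_def by meson
    have own: "block P j (state R j s) \<in> X_block t j (Suc n)" if "Suc l \<le> s" "s \<le> k" for s
      by (rule own_block_after_update[of ?e t n l])
        (use Suc.IH start l that Suc.prems(2) in auto)
    show "block P j (state R i k) \<in> X_block t j (Suc n)"
    proof (cases "j = i")
      case True
      then show ?thesis using own[of k] l(3) Suc.prems(1) by simp
    next
      case False
      then obtain r where r: "r \<le> cycle_end P R t (Suc n)" "received R i j r" "Suc l \<le> tau R i j r"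
        using rec ij by blast
      then obtain s where "Suc l \<le> s" "s \<le> k" "block P j (state R i k) = block P j (state R j s)"
        using copy_after_receipt[of i j r "Suc l" k] Suc.prems(1) by auto
      then show ?thesis using own by simp
    qed
  qed
qed

text \<open>
  \<open>cycles\<close> counts the cycle ends up to the first transmission to the cloud. Since cycle ends
  increase strictly, the counted indices are exactly \<open>1, \<dots>, cycles P R t\<close>; if there are none, the
  bound is the start of the epoch, which precedes every transmission.
\<close>

lemma cycle_end_cycles_le: "cycle_end P R t (cycles P R t) \<le> Min (range (\<lambda>i. cloud_sent R i t))"
proof -
  define m where "m = Min (range (\<lambda>i. cloud_sent R i t))"
  define S where "S = {n. 1 \<le> n \<and> cycle_end P R t n \<le> m}"
  have "S \<subseteq> {..m}"
  proof
    fix n assume "n \<in> S"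
    then have "cycle_end P R t n \<le> m" by (simp add: S_def)
    with strict_mono_imp_increasing[OF strict_mono_cycle_end, of n t] show "n \<in> {..m}"
      unfolding atMost_iff by (rule order_trans)
  qed
  then have fin: "finite S" by (rule finite_subset) simp
  have cycles: "cycles P R t = card S"
    unfolding cycles_def S_def m_def ..
  show ?thesis
    unfolding cycles m_def[symmetric]
  proof (cases "S = {}")
    case True
    have "switch R t \<le> m"
      unfolding m_def
    proof (rule Min.boundedI; (safe)?)
      fix i
      have "switch R t < tau_c R i t" using timing unfolding timing_requirements_def by blast
      also have "\<dots> \<le> cloud_sent R i t" unfolding tau_c_def by (rule stamp_le)
      finally show "switch R t \<le> cloud_sent R i t" by simp
    qed auto
    with True show "cycle_end P R t (card S) \<le> m" by simp
  next
    case False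
    then have "Max S \<in> S" using fin by simp
    then have Max: "cycle_end P R t (Max S) \<le> m" by (simp add: S_def)
    have "n \<in> S" if "1 \<le> n" "n \<le> Max S" for n
      using that Max strict_mono_less_eq[OF strict_mono_cycle_end, of t n "Max S"]
      by (simp add: S_def)
    then have "S = {1..Max S}"
      using fin by (auto simp: S_def)
    then have "card S = Max S" by (metis card_atLeastAtMost diff_Suc_1 One_nat_def)
    with Max show "cycle_end P R t (card S) \<le> m" by simp
  qed
qed

lemma cloud_state_in_X_set: "cloud_state P R t \<in> X_set P \<gamma> R t (cycles P R t)"
  unfolding X_set_iff_blocks
proof
  fix i
  have "block P i (cloud_state P R t) = block P i (state R i (cloud_sent R i t))"
    unfolding cloud_state_def block_sum_blocks tau_c_def by (rule own_block_stamp)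
  moreover have "informed t (cycles P R t) (cloud_sent R i t)"
  proof (rule informed_after_cycles)
    have "Min (range (\<lambda>i. cloud_sent R i t)) \<le> cloud_sent R i t" by (intro Min_le) auto
    with cycle_end_cycles_le show "cycle_end P R t (cycles P R t) \<le> cloud_sent R i t"
      by (rule order_trans)
    show "cloud_sent R i t \<le> switch R (Suc t)"
      using timing unfolding timing_requirements_def by blast
  qed
  ultimately show "block P i (cloud_state P R t) \<in> X_block t i (cycles P R t)"
    by (simp add: informed_def)
qed

lemma cloud_state_feasible: "cloud_state P R t \<in> feasible P"
  using cloud_state_in_X_set by (simp add: X_set_def)

lemma q_p_nonneg: "0 \<le> q_p P \<gamma>"
  by (simp add: q_p_def)

lemma dist_cloud_state_x_hat:
  "norm (cloud_state P R t - x_hat P R t) \<le> sqrt (real CARD('a)) * L_x P * q_p P \<gamma> ^ cycles P R t"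
proof -
  have "D_switch P R t \<le> L_x P"
    unfolding D_switch_def
    by (rule Max.boundedI)
      (auto intro!: norm2inf_feasible_le_L_x standing state_feasible x_hat_minimizes)
  then have "q_p P \<gamma> ^ cycles P R t * D_switch P R t \<le> q_p P \<gamma> ^ cycles P R t * L_x P"
    using q_p_nonneg by (intro mult_left_mono) auto
  moreover have "norm2inf P (cloud_state P R t - x_hat P R t) \<le> q_p P \<gamma> ^ cycles P R t * D_switch P R t"
    using cloud_state_in_X_set[of t] by (simp add: X_set_def)
  ultimately have "norm2inf P (cloud_state P R t - x_hat P R t) \<le> q_p P \<gamma> ^ cycles P R t * L_x P"
    by linarith
  then have "sqrt (real CARD('a)) * norm2inf P (cloud_state P R t - x_hat P R t)
    \<le> sqrt (real CARD('a)) * (q_p P \<gamma> ^ cycles P R t * L_x P)"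
    by (intro mult_left_mono) auto
  with norm_le_norm2inf
  have "norm (cloud_state P R t - x_hat P R t)
    \<le> sqrt (real CARD('a)) * (q_p P \<gamma> ^ cycles P R t * L_x P)"
    by (rule order_trans)
  then show ?thesis
    by (simp only: mult_ac)
qed

end

section \<open>Contraction of the dual iteration\<close>

text \<open>
  In the application \<open>a\<close> is the error in the constraint values due to the inexact primal
  minimization and \<open>b\<close> their change between two exact minimizers at distance \<open>d\<close>. Expand the
  square. The terms in \<open>\<Delta> \<bullet> b\<close> and \<open>\<parallel>b\<parallel>\<^sup>2\<close> are together nonpositive under the step size condition,
  \<open>2 c r (\<Delta> \<bullet> a)\<close> is absorbed by \<open>\<parallel>r \<Delta> - c a\<parallel>\<^sup>2 \<ge> 0\<close>, and only the cross term \<open>a \<bullet> b\<close> remains.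
\<close>

lemma norm_power2_perturbed_step_le:
  fixes \<Delta> a b :: "'a::real_inner"
  assumes mono: "\<alpha> * d\<^sup>2 \<le> - (\<Delta> \<bullet> b)" and b: "norm b \<le> G * d"
    and "0 \<le> c" "0 \<le> r" and step: "r * G\<^sup>2 \<le> 2 * c * \<alpha>"
  shows "(norm (c *\<^sub>R \<Delta> + r *\<^sub>R (a + b)))\<^sup>2
    \<le> (c\<^sup>2 + r\<^sup>2) * ((norm \<Delta>)\<^sup>2 + (norm a)\<^sup>2) + 2 * r\<^sup>2 * (norm a * norm b)"
proof -
  have "2 * (c * r) * (\<Delta> \<bullet> a) \<le> r\<^sup>2 * (norm \<Delta>)\<^sup>2 + c\<^sup>2 * (norm a)\<^sup>2"
    using zero_le_power2[of "norm (r *\<^sub>R \<Delta> - c *\<^sub>R a)"] unfolding power2_norm_eq_inner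
    by (simp add: inner_simps inner_commute power2_eq_square algebra_simps)
  moreover have "2 * r\<^sup>2 * (a \<bullet> b) \<le> 2 * r\<^sup>2 * (norm a * norm b)"
    by (intro mult_left_mono norm_cauchy_schwarz) simp
  moreover have "2 * (c * r) * (\<Delta> \<bullet> b) + r\<^sup>2 * (norm b)\<^sup>2 \<le> 0"
  proof -
    have "(norm b)\<^sup>2 \<le> (G * d)\<^sup>2"
      using b by (intro power_mono) auto
    then have "r\<^sup>2 * (norm b)\<^sup>2 \<le> r\<^sup>2 * (G * d)\<^sup>2"
      by (intro mult_left_mono) auto
    also have "\<dots> = r * d\<^sup>2 * (r * G\<^sup>2)"
      by (simp add: power2_eq_square)
    also have "\<dots> \<le> r * d\<^sup>2 * (2 * c * \<alpha>)"
      using step assms by (intro mult_left_mono) auto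
    also have "\<dots> = 2 * (c * r) * (\<alpha> * d\<^sup>2)" by simp
    also have "\<dots> \<le> 2 * (c * r) * (- (\<Delta> \<bullet> b))"
      using mono assms by (intro mult_left_mono) auto
    finally show ?thesis by simp
  qed
  moreover have "(norm (c *\<^sub>R \<Delta> + r *\<^sub>R (a + b)))\<^sup>2 = c\<^sup>2 * (norm \<Delta>)\<^sup>2 + r\<^sup>2 * (norm a)\<^sup>2
      + r\<^sup>2 * (norm b)\<^sup>2 + 2 * (c * r) * (\<Delta> \<bullet> a) + 2 * (c * r) * (\<Delta> \<bullet> b) + 2 * r\<^sup>2 * (a \<bullet> b)"
    unfolding power2_norm_eq_inner
    by (simp add: inner_simps inner_commute power2_eq_square algebra_simps)
  ultimately show ?thesis by (simp add: algebra_simps)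
qed

text \<open>
  Both \<open>dual R (Suc t)\<close> and \<open>muhat\<close> are projections onto \<open>dual_set P\<close>. As projecting is nonexpansive,
  only the unprojected points need to be compared. The bound on \<open>\<rho>\<close> by the first term of
  \<open>rho0 P\<close> is the step size condition of the previous lemma with \<open>c = 1 - \<rho>\<beta>\<close>.
\<close>

lemma (in asynchronous_run) dual_step_le:
  assumes saddle: "saddle_point P xhat muhat"
    and reg: "0 < reg_p P" "0 < reg_d P" and \<rho>: "0 < \<rho>" "\<rho> < rho0 P"
  shows "(norm (dual R (Suc t) - muhat))\<^sup>2 \<le> q_d P \<rho> * (norm (dual R t - muhat))\<^sup>2 +
    (q_d P \<rho> * real CARD('a) * (M_g P)\<^sup>2 * (L_x P)\<^sup>2 * q_p P \<gamma> ^ (2 * cycles P R t) +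
     2 * sqrt (real CARD('a)) * \<rho>\<^sup>2 * (M_g P)\<^sup>2 * L_x P * D_x P * q_p P \<gamma> ^ cycles P R t)"
proof -
  define c where "c = 1 - \<rho> * reg_d P"
  define \<Delta> where "\<Delta> = dual R t - muhat"
  define a where "a = constr P (cloud_state P R t) - constr P (x_hat P R t)"
  define b where "b = constr P (x_hat P R t) - constr P xhat"
  have feas: "xhat \<in> feasible P" "x_hat P R t \<in> feasible P" "cloud_state P R t \<in> feasible P"
    using saddle x_hat_minimizes(1)[OF standing] cloud_state_feasible by (auto simp: saddle_point_def)
  have Mg: "0 \<le> M_g P"
    using norm_constr_diff_le(2)[OF standing feas(1,1)] .

  have "\<rho> < 2 * reg_p P / ((M_g P)\<^sup>2 + 2 * reg_p P * reg_d P)"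
    using \<rho> by (simp add: rho0_def)
  moreover have pos: "0 < (M_g P)\<^sup>2 + 2 * reg_p P * reg_d P"
    using reg by (simp add: add_nonneg_pos)
  ultimately have "\<rho> * ((M_g P)\<^sup>2 + 2 * reg_p P * reg_d P) < 2 * reg_p P"
    by (simp add: pos_less_divide_eq)
  then have step: "\<rho> * (M_g P)\<^sup>2 < 2 * c * reg_p P"
    by (simp add: c_def algebra_simps)
  moreover have "0 \<le> \<rho> * (M_g P)\<^sup>2" using \<rho> by simp
  ultimately have c: "0 \<le> c"
    using reg(1) by (smt (verit) mult_nonneg_nonneg mult_neg_pos)

  have "norm (dual R (Suc t) - muhat) \<le> norm (c *\<^sub>R \<Delta> + \<rho> *\<^sub>R (a + b))"
  proof -
    let ?y = "dual R t + \<rho> *\<^sub>R (constr P (cloud_state P R t) - reg_d P *\<^sub>R dual R t)"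
    let ?z = "muhat + \<rho> *\<^sub>R (constr P xhat - reg_d P *\<^sub>R muhat)"
    have "dual R (Suc t) = closest_point (dual_set P) ?y"
      using run unfolding primal_dual_run_def by blast
    moreover have "closest_point (dual_set P) ?z = muhat"
      using saddle_point_multiplier_fixed_point[OF standing _ _ _ saddle] reg \<rho> by simp
    moreover have "dual_set P \<noteq> {}"
      using dual_in_dual_set[OF run] by blast
    ultimately have "dist (dual R (Suc t)) muhat \<le> dist ?y ?z"
      using closest_point_lipschitz[OF convex_dual_set closed_dual_set, of P ?y ?z] by simp
    moreover have "?y - ?z = c *\<^sub>R \<Delta> + \<rho> *\<^sub>R (a + b)"
      by (simp add: c_def \<Delta>_def a_def b_def algebra_simps)
    ultimately show ?thesis by (simp add: dist_norm)
  qed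
  then have "(norm (dual R (Suc t) - muhat))\<^sup>2 \<le> (norm (c *\<^sub>R \<Delta> + \<rho> *\<^sub>R (a + b)))\<^sup>2"
    by (intro power_mono) auto
  also have "\<dots> \<le> (c\<^sup>2 + \<rho>\<^sup>2) * ((norm \<Delta>)\<^sup>2 + (norm a)\<^sup>2) + 2 * \<rho>\<^sup>2 * (norm a * norm b)"
  proof (rule norm_power2_perturbed_step_le)
    have "reg_p P * (norm (x_hat P R t - xhat))\<^sup>2
      \<le> (dual R t - muhat) \<bullet> (constr P xhat - constr P (x_hat P R t))"
    proof (rule inner_constr_minimizers_ge[OF standing dual_nonneg])
      show "Lagr P (x_hat P R t) (dual R t) \<le> Lagr P z (dual R t)" if "z \<in> feasible P" for z
        using x_hat_minimizes(2)[OF standing that] .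
    qed (use saddle feas in \<open>auto simp: saddle_point_def\<close>)
    then show "reg_p P * (norm (x_hat P R t - xhat))\<^sup>2 \<le> - (\<Delta> \<bullet> b)"
      by (simp add: \<Delta>_def b_def inner_simps)
    show "norm b \<le> M_g P * norm (x_hat P R t - xhat)"
      unfolding b_def using feas by (intro norm_constr_diff_le(1) standing)
  qed (use step c \<rho> in auto)
  also have "\<dots> \<le> q_d P \<rho> * (norm \<Delta>)\<^sup>2 +
    (q_d P \<rho> * real CARD('a) * (M_g P)\<^sup>2 * (L_x P)\<^sup>2 * q_p P \<gamma> ^ (2 * cycles P R t) +
     2 * sqrt (real CARD('a)) * \<rho>\<^sup>2 * (M_g P)\<^sup>2 * L_x P * D_x P * q_p P \<gamma> ^ cycles P R t)"
  proof -
    let ?A = "sqrt (real CARD('a)) * L_x P * q_p P \<gamma> ^ cycles P R t"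
    have q: "q_d P \<rho> = c\<^sup>2 + \<rho>\<^sup>2" by (simp add: q_d_def c_def)
    have "norm a \<le> M_g P * norm (cloud_state P R t - x_hat P R t)"
      unfolding a_def using feas by (intro norm_constr_diff_le(1) standing)
    also have "\<dots> \<le> M_g P * ?A"
      using Mg by (intro mult_left_mono dist_cloud_state_x_hat)
    finally have a: "norm a \<le> M_g P * ?A" .
    then have "(norm a)\<^sup>2 \<le> (M_g P * ?A)\<^sup>2" by (intro power_mono) auto
    also have "\<dots> = real CARD('a) * (M_g P)\<^sup>2 * (L_x P)\<^sup>2 * q_p P \<gamma> ^ (2 * cycles P R t)"
      by (simp add: power_mult_distrib power_even_eq mult_ac)
    finally have 1: "(c\<^sup>2 + \<rho>\<^sup>2) * (norm a)\<^sup>2 \<le> (c\<^sup>2 + \<rho>\<^sup>2) *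
      (real CARD('a) * (M_g P)\<^sup>2 * (L_x P)\<^sup>2 * q_p P \<gamma> ^ (2 * cycles P R t))"
      by (intro mult_left_mono) auto
    have "norm b \<le> M_g P * norm (x_hat P R t - xhat)"
      unfolding b_def using feas by (intro norm_constr_diff_le(1) standing)
    also have "\<dots> \<le> M_g P * D_x P"
      using Mg diameter_bounded_bound[OF compact_imp_bounded[OF compact_feasible[OF standing]] feas(2,1)]
      by (intro mult_left_mono) (auto simp: D_x_def dist_norm)
    finally have "norm a * norm b \<le> (M_g P * ?A) * (M_g P * D_x P)"
      using a by (intro mult_mono') auto
    then have 2: "2 * \<rho>\<^sup>2 * (norm a * norm b) \<le> 2 * \<rho>\<^sup>2 * ((M_g P * ?A) * (M_g P * D_x P))"
      by (intro mult_left_mono) auto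
    show ?thesis
      unfolding q using add_mono[OF 1 2] by (simp add: power2_eq_square algebra_simps)
  qed
  finally show ?thesis by (simp add: \<Delta>_def)
qed

lemma linear_recursion_le:
  fixes u :: "nat \<Rightarrow> real"
  assumes "\<And>t. u (Suc t) \<le> q * u t + w t" "0 \<le> q"
  shows "u (Suc t) \<le> q ^ (t + 1) * u 0 + (\<Sum>l = 0..t. q ^ (t - l) * w l)"
proof (induction t)
  case 0
  then show ?case using assms(1)[of 0] by simp
next
  case (Suc t)
  have "u (Suc (Suc t)) \<le> q * u (Suc t) + w (Suc t)" by (rule assms)
  also have "\<dots> \<le> q * (q ^ (t + 1) * u 0 + (\<Sum>l = 0..t. q ^ (t - l) * w l)) + w (Suc t)"
    using Suc assms(2) by (intro add_right_mono mult_left_mono)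
  also have "q * (\<Sum>l = 0..t. q ^ (t - l) * w l) = (\<Sum>l = 0..t. q ^ (Suc t - l) * w l)"
    unfolding sum_distrib_left by (rule sum.cong) (auto simp: Suc_diff_le)
  then have "q * (q ^ (t + 1) * u 0 + (\<Sum>l = 0..t. q ^ (t - l) * w l)) + w (Suc t) =
    q ^ (Suc t + 1) * u 0 + (\<Sum>l = 0..Suc t. q ^ (Suc t - l) * w l)"
    by (simp add: distrib_left)
  finally show ?case .
qed

theorem theorem1:
  fixes P :: "('n::finite, 'm::finite, 'a::finite) problem"
    and R :: "('n, 'm, 'a) run"
    and xhat :: "real^'n" and muhat :: "real^'m"
    and \<gamma> \<rho> :: real
  assumes "standing_assumptions P"
    and "0 < reg_p P" and "reg_p P < L_p P" and "0 < reg_d P"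
    and "saddle_point P xhat muhat"
    and "primal_dual_run P \<gamma> \<rho> R"
    and "timing_requirements P R"
    and "\<And>t. X_set_properties P \<gamma> R t"
    and "0 < \<gamma>" and "\<gamma> < 2 / L_p P"
    and "0 < \<rho>" and "\<rho> < rho0 P"
  shows "0 < q_d P \<rho> \<and> q_d P \<rho> < 1 \<and>
    (\<forall>t. (norm (dual R (Suc t) - muhat))\<^sup>2 \<le>
       q_d P \<rho> ^ (t + 1) * (norm (dual R 0 - muhat))\<^sup>2 +
       (\<Sum>l = 0..t. q_d P \<rho> ^ (t - l) *
          (q_d P \<rho> * real CARD('a) * (M_g P)\<^sup>2 * (L_x P)\<^sup>2 * q_p P \<gamma> ^ (2 * cycles P R l) +
           2 * sqrt (real CARD('a)) * \<rho>\<^sup>2 * (M_g P)\<^sup>2 * L_x P * D_x P * q_p P \<gamma> ^ cycles P R l)))"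
proof -
  interpret asynchronous_run P R \<gamma> \<rho>
    using assms by unfold_locales
  have q_pos: "0 < q_d P \<rho>"
    using \<open>0 < \<rho>\<close> by (simp add: q_d_def add_nonneg_pos)
  moreover have "q_d P \<rho> < 1"
  proof -
    have "\<rho> < 2 * reg_d P / (1 + (reg_d P)\<^sup>2)"
      using assms(12) by (simp add: rho0_def)
    then have "\<rho> * (1 + (reg_d P)\<^sup>2) < 2 * reg_d P"
      by (simp add: pos_less_divide_eq add_pos_nonneg)
    then have "\<rho> * (\<rho> * (1 + (reg_d P)\<^sup>2)) < \<rho> * (2 * reg_d P)"
      using \<open>0 < \<rho>\<close> by (rule mult_strict_left_mono)
    then show ?thesis
      unfolding q_d_def by (simp add: power2_eq_square algebra_simps)
  qed
  moreover note linear_recursion_le[of "\<lambda>t. (norm (dual R t - muhat))\<^sup>2",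
      OF dual_step_le[OF assms(5,2,4,11,12)] less_imp_le[OF q_pos]]
  ultimately show ?thesis by blast
qed

end
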